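(* Let $(X_t)_{0\le t<\tau_\partial}$ satisfy Assumption (E), with $a$, $(\tilde P_t)$ and $\tilde\pi$ as there, and set $\lambda:=a\,\tilde\pi\tilde P_1 1>0$. Then there exists a bounded Borel function $h:\chi\to(0,\infty)$ (everywhere strictly positive) such that $P_th(x)=\lambda^th(x)$ for all $x\in\chi$ and $t\ge0$. If in addition $V\subseteq\chi$ is open and, for every $t\ge0$, $P_t$ maps bounded non-negative lower semicontinuous functions that are continuous on $V$ to bounded non-negative lower semicontinuous functions that are continuous on $V$, then $h$ may be taken continuous on $V$.
   Context: $\chi$ is a metric space with Borel $\sigma$-algebra and a distinguished $\sigma$-finite Borel measure $\Lambda$ of full support. $(X_t)_{0\le t<\tau_\partial}$ is a killed Markov process on $\chi$ with absorption time $\tau_\partial$ and submarkovian semigroup $P_t(x,A)=\mathbb P_x(X_t\in A,\tau_\partial>t)$; $K1(x)=K(x,\chi)$; for a measure $\mu$, $\mu K=\int\mu(dx)K(x,\cdot)$. A QSD of a submarkovian semigroup $(\tilde P_t)$ is a probability $\tilde\pi$ with $\tilde\pi\tilde P_t=(\tilde\pi\tilde P_t1)\tilde\pi$ for all $t$. A submarkovian kernel (semigroup) is lower semicontinuous if it maps bounded continuous non-negative functions to lower semicontinuous functions. $C_{b,\gg}(\chi)$ = bounded continuous functions with positive infimum; $\mathcal P_\infty(\Lambda)$ = probability measures $\ll\Lambda$ with density in $L^\infty(\Lambda)$. Assumption (E): $\chi$ is separable; $\mathbb P_x(\tau_\partial>t)>0$ for all $x\in\chi$, $t<\infty$; there exist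 $c_0>0$, $t_0>0$, $\nu\in\mathcal P(\chi)$ with $\mathbb P_x(X_{t_0}\in\cdot\mid\tau_\partial>t_0)\ge c_0\nu$ for all $x$; $(P_t)$ is lower semicontinuous; there exist $\psi\in C_{b,\gg}(\chi)$, $a>0$ and a submarkovian semigroup $(\tilde P_t)$ with $\psi(x)\Lambda(dx)P_t(x,dy)=a^t\psi(y)\Lambda(dy)\tilde P_t(y,dx)$ for all $t\ge0$; $(\tilde P_t)$ has a QSD $\tilde\pi\in\mathcal P_\infty(\Lambda)$; and there exist an open $\mathcal O\subseteq\chi$, $c_1>0$, $t_1>0$ with $\tilde\pi\ge c_1\Lambda|_{\mathcal O}$ and $\mathbb P_\nu(X_{t_1}\in\mathcal O)>0$. *)

theory Defs
  imports "HOL-Probability.Probability"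
begin

definition submarkov_kernel :: "('a::topological_space \<Rightarrow> 'a measure) \<Rightarrow> bool" where
  "submarkov_kernel K \<longleftrightarrow> K \<in> borel \<rightarrow>\<^sub>M subprob_algebra borel"

definition submarkov_semigroup :: "(real \<Rightarrow> 'a::topological_space \<Rightarrow> 'a measure) \<Rightarrow> bool" where
  "submarkov_semigroup P \<longleftrightarrow>
     (\<forall>t\<ge>0. submarkov_kernel (P t)) \<and>
     (\<forall>x. P 0 x = return borel x) \<and>
     (\<forall>s\<ge>0. \<forall>t\<ge>0. \<forall>x. \<forall>A\<in>sets borel.
        emeasure (P (s + t) x) A = (\<integral>\<^sup>+ y. emeasure (P t y) A \<partial>P s x))"

definition kact :: "('a \<Rightarrow> 'a measure) \<Rightarrow> ('a \<Rightarrow> real) \<Rightarrow> 'a \<Rightarrow> real" where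
  "kact K f x = (\<integral> y. f y \<partial>K x)"

definition lsc :: "('a::topological_space \<Rightarrow> real) \<Rightarrow> bool" where
  "lsc f \<longleftrightarrow> (\<forall>c. open {x. c < f x})"

definition lsc_kernel :: "('a::topological_space \<Rightarrow> 'a measure) \<Rightarrow> bool" where
  "lsc_kernel K \<longleftrightarrow> (\<forall>f. continuous_on UNIV f \<and> bounded (range f) \<and> (\<forall>x. 0 \<le> f x)
       \<longrightarrow> lsc (kact K f))"

definition Cb_pos :: "('a::topological_space \<Rightarrow> real) \<Rightarrow> bool" where
  "Cb_pos f \<longleftrightarrow> continuous_on UNIV f \<and> bounded (range f) \<and> (\<exists>c>0. \<forall>x. c \<le> f x)"

definition is_QSD :: "(real \<Rightarrow> 'a::topological_space \<Rightarrow> 'a measure) \<Rightarrow> 'a measure \<Rightarrow> bool" where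
  "is_QSD Q \<pi> \<longleftrightarrow> prob_space \<pi> \<and> sets \<pi> = sets borel \<and>
     (\<forall>t\<ge>0. \<forall>A\<in>sets borel.
        (\<integral>\<^sup>+ y. emeasure (Q t y) A \<partial>\<pi>) = (\<integral>\<^sup>+ y. emeasure (Q t y) UNIV \<partial>\<pi>) * emeasure \<pi> A)"

definition P_infty :: "'a::topological_space measure \<Rightarrow> 'a measure \<Rightarrow> bool" where
  "P_infty \<Lambda> \<pi> \<longleftrightarrow> prob_space \<pi> \<and>
     (\<exists>g \<in> borel_measurable borel. (\<forall>x. 0 \<le> g x) \<and> bounded (range g) \<and>
        \<pi> = density \<Lambda> (\<lambda>x. ennreal (g x)))"

end

(*
The density g of the QSD with respect to Lambda gives, by duality, h0 = g / psi with
P_t h0 = lam^t h0 Lambda-almost everywhere.  As null sets matter for P_t(x, .), h0 is replaced by its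
greatest lower semicontinuous minorant u: since P_t preserves lower semicontinuity, lam^-t P_t u is
again such a minorant, so lam^-t P_t u decreases in t at every point, and its limit h is an
eigenfunction everywhere.  Duality and the minorisation force nu to be absolutely continuous with
respect to Lambda, hence nu P_t 1 >= kappa lam^t; together with the minorisation this keeps
lam^-t P_t u(x) away from 0.  Finally the h-transform of P satisfies a uniform Doeblin condition, so h
is, up to constants, a uniform limit of the functions lam^-t P_t 1, which are continuous on V.
*)

theory Submission
  imports Defs
begin

section \<open>Submarkovian kernels and bounded non-negative functions\<close>

text \<open>Duality controls \<open>P t x\<close> only for almost every starting point. At an
  exceptional point \<open>P t x\<close> may charge \<open>\<Lambda>\<close>-null sets, so that
  changing the density on a null set changes the action of \<open>P t\<close> there. Lower
  semicontinuity makes a pointwise repair possible: full support turns an almost everywhere bound by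
  a constant into a bound everywhere, separability reduces the uncountable supremum behind the
  minorant to countably many functions, and openness of \<open>\<O>\<close> makes a multiple of its
  indicator a competitor, so that the minorant is not trivial. The minorant may still vanish at some
  points; positivity of the limit comes from using the minorisation at both ends of a long time
  interval. No regularity in time is assumed: the eigenvalue is a power of its value at time 1
  because the survival probabilities of the dual semigroup, started from its QSD, are multiplicative
  and at most 1. A decreasing limit of lower semicontinuous functions need not be semicontinuous,
  which is why continuity on \<open>V\<close> calls for a separate, uniform approximation.\<close>

definition bpos :: "('a::topological_space \<Rightarrow> real) \<Rightarrow> bool" where
  "bpos f \<longleftrightarrow> f \<in> borel_measurable borel \<and> (\<forall>x. 0 \<le> f x) \<and> bounded (range f)"

lemma bposI:
  assumes "f \<in> borel_measurable borel" "\<And>x. 0 \<le> f x" "\<And>x. f x \<le> B"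
  shows "bpos f"
  unfolding bpos_def using assms by (auto simp: bounded_iff intro!: exI[of _ B])

lemma bposD:
  assumes "bpos f"
  shows "f \<in> borel_measurable borel" "0 \<le> f x"
  using assms by (auto simp: bpos_def)

lemma bpos_bound:
  assumes "bpos f"
  obtains B where "0 < B" "\<And>x. f x \<le> B"
proof -
  obtain B where "\<forall>y\<in>range f. norm y \<le> B"
    using assms unfolding bpos_def bounded_iff by blast
  then have "f x \<le> max B 1" for x
    by (simp add: abs_le_iff le_max_iff_disj)
  then show ?thesis by (intro that[of "max B 1"]) auto
qed

lemma bpos_const: "0 \<le> c \<Longrightarrow> bpos (\<lambda>_. c)"
  by (rule bposI[of _ c]) auto

lemma bpos_indicator: "A \<in> sets borel \<Longrightarrow> bpos (indicator A)"
  by (rule bposI[of _ 1]) (auto simp: indicator_def)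

lemma bpos_cmult:
  assumes "bpos f" "0 \<le> c" shows "bpos (\<lambda>x. c * f x)"
proof -
  obtain B where "\<And>x. f x \<le> B" using bpos_bound[OF assms(1)] by metis
  then show ?thesis using assms bposD[OF assms(1)]
    by (intro bposI[of _ "c * B"]) (auto intro: mult_left_mono)
qed

lemma bpos_le:
  assumes "bpos g" "f \<in> borel_measurable borel" "\<And>x. 0 \<le> f x" "\<And>x. f x \<le> g x"
  shows "bpos f"
proof -
  obtain B where "\<And>x. g x \<le> B" using bpos_bound[OF assms(1)] by metis
  then show ?thesis using assms
    by (intro bposI[of _ "B"]) (auto intro: order_trans)
qed

lemma bpos_diff:
  assumes "bpos f" "bpos g" "\<And>x. g x \<le> f x" shows "bpos (\<lambda>x. f x - g x)"
  by (rule bpos_le[OF assms(1)]) (use assms bposD[OF assms(1)] bposD[OF assms(2)] in auto)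

lemma integrable_bpos:
  assumes "finite_measure M" "sets M = sets borel" "bpos f"
  shows "integrable M f"
proof -
  interpret finite_measure M by fact
  obtain B where "\<And>x. f x \<le> B" using bpos_bound[OF assms(3)] by metis
  with assms bposD[OF assms(3)] show ?thesis
    by (intro integrable_const_bound[of _ B]) (auto cong: measurable_cong_sets)
qed

lemma kact_cmult: "kact K (\<lambda>y. c * f y) x = c * kact K f x"
  unfolding kact_def by simp

context
  fixes K :: "'a::topological_space \<Rightarrow> 'a measure"
  assumes K: "submarkov_kernel K"
begin

lemma kernel_measurable: "K \<in> borel \<rightarrow>\<^sub>M subprob_algebra borel"
  using K by (simp add: submarkov_kernel_def)

lemma kernel_sets[simp, measurable_cong]: "sets (K x) = sets borel"
  using sets_kernel[OF kernel_measurable] by simp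

lemma kernel_space[simp]: "space (K x) = UNIV"
  using sets_eq_imp_space_eq[OF kernel_sets] by simp

lemma kernel_subprob: "subprob_space (K x)"
  using subprob_space_kernel[OF kernel_measurable] by simp

lemma kernel_finite: "finite_measure (K x)"
  using kernel_subprob subprob_space_def by blast

lemma kernel_integrable: "bpos f \<Longrightarrow> integrable (K x) f"
  by (intro integrable_bpos kernel_finite) auto

text \<open>The bridge between the Bochner integral in \<open>kact\<close> and the extended integral
  in which the semigroup law and the duality are stated; bounded functions are integrable because a
  kernel has mass at most 1.\<close>

lemma ennreal_kact:
  assumes "bpos f"
  shows "ennreal (kact K f x) = (\<integral>\<^sup>+ y. ennreal (f y) \<partial>K x)"
  unfolding kact_def using bposD(2)[OF assms]
  by (intro nn_integral_eq_integral[symmetric] kernel_integrable assms) auto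

lemma kact_mono:
  assumes "bpos f" "bpos g" "\<And>y. f y \<le> g y"
  shows "kact K f x \<le> kact K g x"
  unfolding kact_def using assms by (intro integral_mono kernel_integrable) auto

lemma kact_nonneg: "bpos f \<Longrightarrow> 0 \<le> kact K f x"
  unfolding kact_def by (intro integral_nonneg_AE) (auto dest: bposD)

lemma kact_diff: "bpos f \<Longrightarrow> bpos g \<Longrightarrow> kact K (\<lambda>y. f y - g y) x = kact K f x - kact K g x"
  unfolding kact_def by (intro Bochner_Integration.integral_diff kernel_integrable)

lemma kact_indicator: "A \<in> sets borel \<Longrightarrow> kact K (indicator A) x = measure (K x) A"
  unfolding kact_def by simp

lemma kact_const: "kact K (\<lambda>_. c) x = c * measure (K x) UNIV"
  unfolding kact_def by (simp add: lebesgue_integral_const)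

lemma kact_bound:
  assumes "bpos f" "\<And>y. f y \<le> B" "0 \<le> B"
  shows "kact K f x \<le> B"
proof -
  have "kact K f x \<le> kact K (\<lambda>_. B) x"
    by (intro kact_mono bpos_const assms)
  also have "\<dots> \<le> B * 1"
    unfolding kact_const
    using assms(3) subprob_space.subprob_measure_le_1[OF kernel_subprob]
    by (intro mult_left_mono) auto
  finally show ?thesis by simp
qed

lemma kact_bpos:
  assumes "bpos f" shows "bpos (kact K f)"
proof -
  obtain B where "0 < B" "\<And>x. f x \<le> B" using bpos_bound[OF assms] by metis
  moreover have "kact K f \<in> borel_measurable borel"
    unfolding kact_def
    by (rule measurable_compose[OF kernel_measurable
          integral_measurable_subprob_algebra[OF bposD(1)[OF assms]]])
  ultimately show ?thesis
    using assms by (intro bposI[of "kact K f" B] kact_nonneg[OF assms] kact_bound[OF assms]) auto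
qed

lemma kact_tendsto:
  assumes "\<And>n. bpos (F n)" "bpos f" "\<And>y. (\<lambda>n. F n y) \<longlonglongrightarrow> f y" "\<And>n y. F n y \<le> B"
  shows "(\<lambda>n. kact K (F n) x) \<longlonglongrightarrow> kact K f x"
  unfolding kact_def
proof (rule integral_dominated_convergence[where w="\<lambda>_. B"])
  show "integrable (K x) (\<lambda>_. B)"
    using kernel_finite by (simp add: finite_measure.integrable_const)
qed (use assms(4) bposD[OF assms(1)] bposD[OF assms(2)] in \<open>auto intro!: assms cong: measurable_cong_sets\<close>)

end

section \<open>Chapman-Kolmogorov for functions\<close>

lemma semigroup_kernel: "submarkov_semigroup P \<Longrightarrow> 0 \<le> t \<Longrightarrow> submarkov_kernel (P t)"
  by (simp add: submarkov_semigroup_def)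

text \<open>The semigroup law speaks of sets only. It identifies \<open>P (s + t) x\<close> with the
  bind of \<open>P s x\<close> and \<open>P t\<close> as measures, after which any function of class
  \<open>bpos\<close> can be integrated.\<close>

lemma kact_semigroup:
  assumes P: "submarkov_semigroup P" and "0 \<le> s" "0 \<le> t" and f: "bpos f"
  shows "kact (P (s + t)) f x = kact (P s) (kact (P t) f) x"
proof -
  note K = semigroup_kernel[OF P]
  have Ms: "P t \<in> P s x \<rightarrow>\<^sub>M subprob_algebra borel"
    using kernel_measurable[OF K[OF assms(3)]] kernel_sets[OF K[OF assms(2)], of x]
    by (simp cong: measurable_cong_sets)
  have "P (s + t) x = P s x \<bind> P t"
  proof (rule measure_eqI)
    show "sets (P (s + t) x) = sets (P s x \<bind> P t)"
      using assms(2,3) by (subst sets_bind[where N=borel]) (auto simp: kernel_sets K kernel_space)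
    fix A assume "A \<in> sets (P (s + t) x)"
    then have A: "A \<in> sets borel" using assms(2,3) by (simp add: kernel_sets K)
    then show "emeasure (P (s + t) x) A = emeasure (P s x \<bind> P t) A"
      using P assms(2,3) by (subst emeasure_bind[OF _ Ms]) (auto simp: kernel_space K submarkov_semigroup_def)
  qed
  then have "ennreal (kact (P (s + t)) f x) = (\<integral>\<^sup>+ y. ennreal (f y) \<partial>(P s x \<bind> P t))"
    using assms by (simp add: ennreal_kact K)
  also have "\<dots> = (\<integral>\<^sup>+ y. ennreal (kact (P t) f y) \<partial>P s x)"
    using assms bposD(1)[OF f] by (subst nn_integral_bind[OF _ Ms]) (auto simp: ennreal_kact K)
  also have "\<dots> = ennreal (kact (P s) (kact (P t) f) x)"
    using assms by (simp add: ennreal_kact K kact_bpos)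
  finally show ?thesis
    using assms by (simp add: kact_nonneg kact_bpos K)
qed

subsection \<open>Lower semicontinuous functions\<close>

text \<open>Moreau--Yosida regularisation: the inf-convolution of a bounded lower semicontinuous function
  with \<open>n * dist\<close> is \<open>n\<close>-Lipschitz and increases to the function.\<close>

lemma lsc_approx:
  fixes f :: "'a::metric_space \<Rightarrow> real"
  assumes lsc: "lsc f" and nn: "\<And>x. 0 \<le> f x"
  obtains F :: "nat \<Rightarrow> 'a \<Rightarrow> real" where
    "\<And>n. continuous_on UNIV (F n)" "\<And>n x. 0 \<le> F n x" "\<And>n x. F n x \<le> f x"
    "\<And>x. (\<lambda>n. F n x) \<longlonglongrightarrow> f x"
proof
  define F where "F n x = (INF y. f y + real n * dist x y)" for n x
  have bdd: "bdd_below (range (\<lambda>y. f y + real n * dist x y))" for n x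
    by (rule bdd_belowI[of _ 0]) (auto simp: nn)
  have low: "F n x \<le> f y + real n * dist x y" for n x y
    unfolding F_def by (rule cINF_lower[OF bdd]) simp
  show nonneg: "0 \<le> F n x" for n x
    unfolding F_def by (rule cINF_greatest) (auto simp: nn)
  show le: "F n x \<le> f x" for n x
    using low[of n x x] by simp
  have lip: "F n x \<le> F n z + real n * dist x z" for n x z
  proof -
    have "F n x - real n * dist x z \<le> F n z"
      unfolding F_def[of n z]
    proof (rule cINF_greatest)
      fix y
      have "real n * dist x y \<le> real n * dist x z + real n * dist z y"
        by (metis distrib_left dist_triangle mult_left_mono of_nat_0_le_iff)
      with low[of n x y] show "F n x - real n * dist x z \<le> f y + real n * dist z y" by linarith
    qed simp
    then show ?thesis by linarith
  qed
  have "(real n)-lipschitz_on UNIV (F n)" for n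
  proof (rule lipschitz_onI)
    fix x y
    show "dist (F n x) (F n y) \<le> real n * dist x y"
      using lip[of n x y] lip[of n y x] by (auto simp: dist_real_def abs_le_iff dist_commute)
  qed simp
  then show "continuous_on UNIV (F n)" for n
    by (rule lipschitz_on_continuous_on)
  show "(\<lambda>n. F n x) \<longlonglongrightarrow> f x" for x
  proof (rule order_tendstoI)
    fix c assume "c < f x"
    then obtain b where b: "c < b" "b < f x" using dense by blast
    have "open {y. b < f y}" using lsc by (simp add: lsc_def)
    then obtain d where d: "d > 0" "ball x d \<subseteq> {y. b < f y}"
      using b(2) open_contains_ball by (metis mem_Collect_eq)
    \<comment> \<open>Inside the ball the value of \<open>f\<close> already exceeds
      \<open>b\<close>; outside it the penalty alone does, since \<open>N * d > b\<close>.\<close>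
    obtain N :: nat where N: "b / d < N" using reals_Archimedean2 by blast
    have "b \<le> F n x" if "n \<ge> N" for n
      unfolding F_def
    proof (rule cINF_greatest)
      fix y show "b \<le> f y + real n * dist x y"
      proof (cases "dist x y < d")
        case True
        then have "b < f y" using d(2) by (auto simp: subset_iff)
        then show ?thesis by (simp add: add_increasing2 less_imp_le)
      next
        case False
        have "b < real N * d" using N d(1) by (simp add: field_simps)
        also have "\<dots> \<le> real n * dist x y"
          using False that d(1) by (intro mult_mono) auto
        finally show ?thesis using nn[of y] by linarith
      qed
    qed simp
    then show "\<forall>\<^sub>F n in sequentially. c < F n x"
      using b(1) by (auto simp: eventually_sequentially intro: less_le_trans)
  next
    fix c assume "f x < c"
    then show "\<forall>\<^sub>F n in sequentially. F n x < c"
      using le by (intro always_eventually) (auto intro: le_less_trans)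
  qed
qed

lemma lsc_measurable: "lsc f \<Longrightarrow> f \<in> borel_measurable borel"
  unfolding lsc_def by (auto simp: borel_measurable_iff_greater)

text \<open>\<open>lsc_kernel\<close> speaks of continuous functions only. With continuous
  \<open>F n\<close> below \<open>f\<close> and converging to it, the superlevel set of
  \<open>kact K f\<close> is the union of those of \<open>kact K (F n)\<close>: convergence gives
  one inclusion, \<open>F n \<le> f\<close> the other.\<close>

lemma lsc_kact:
  fixes K :: "'a::metric_space \<Rightarrow> 'a measure"
  assumes K: "submarkov_kernel K" "lsc_kernel K" and f: "lsc f" "bpos f"
  shows "lsc (kact K f)"
  unfolding lsc_def
proof
  fix c
  obtain F :: "nat \<Rightarrow> 'a \<Rightarrow> real" where F: "\<And>n. continuous_on UNIV (F n)" "\<And>n x. 0 \<le> F n x" "\<And>n x. F n x \<le> f x"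
    "\<And>x. (\<lambda>n. F n x) \<longlonglongrightarrow> f x"
    using lsc_approx[OF f(1) bposD(2)[OF f(2)]] by metis
  have bF: "bpos (F n)" for n
    by (rule bpos_le[OF f(2)]) (auto intro: borel_measurable_continuous_onI F)
  obtain B where B: "\<And>x. f x \<le> B" using bpos_bound[OF f(2)] by metis
  have lim: "(\<lambda>n. kact K (F n) x) \<longlonglongrightarrow> kact K f x" for x
    by (rule kact_tendsto[OF K(1) bF f(2) F(4), of B]) (auto intro: order_trans[OF F(3) B])
  have le: "kact K (F n) x \<le> kact K f x" for n x
    by (intro kact_mono K bF f F)
  have "{x. c < kact K f x} = (\<Union>n. {x. c < kact K (F n) x})"
  proof (intro set_eqI iffI)
    fix x assume "x \<in> {x. c < kact K f x}"
    then have "\<forall>\<^sub>F n in sequentially. c < kact K (F n) x"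
      using order_tendstoD(1)[OF lim] by simp
    then show "x \<in> (\<Union>n. {x. c < kact K (F n) x})"
      by (auto simp: eventually_sequentially)
  qed (use le in \<open>auto intro: less_le_trans\<close>)
  moreover have "lsc (kact K (F n))" for n
    using K(2) F(1,2) bF[of n] by (auto simp: lsc_kernel_def bpos_def)
  ultimately show "open {x. c < kact K f x}"
    by (auto simp: lsc_def intro: open_UN)
qed

section \<open>Lindelof property and lower semicontinuous minorants\<close>

lemma separable_countable_subcover:
  fixes \<G> :: "'a::metric_space set set"
  assumes sep: "separable_space (euclidean :: 'a topology)" and op: "\<And>U. U \<in> \<G> \<Longrightarrow> open U"
  obtains \<G>' where "countable \<G>'" "\<G>' \<subseteq> \<G>" "\<Union>\<G>' = \<Union>\<G>"
proof -
  obtain D :: "'a set" where D: "countable D" "closure D = UNIV"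
    using sep by (auto simp: separable_space_def)
  \<comment> \<open>Balls with centre in \<open>D\<close> and rational radius form a countable
    family; one member of the cover is chosen for each ball that fits into some member.\<close>
  define I where "I = {p \<in> D \<times> \<rat>. \<exists>U\<in>\<G>. ball (fst p) (snd p) \<subseteq> U}"
  have "\<forall>p\<in>I. \<exists>U\<in>\<G>. ball (fst p) (snd p) \<subseteq> U"
    by (auto simp: I_def)
  then obtain w where w: "\<And>p. p \<in> I \<Longrightarrow> w p \<in> \<G>" "\<And>p. p \<in> I \<Longrightarrow> ball (fst p) (snd p) \<subseteq> w p"
    by metis
  have "countable I"
    unfolding I_def by (rule countable_subset[of _ "D \<times> \<rat>"]) (auto intro: D countable_rat)
  moreover have "\<Union>\<G> \<subseteq> \<Union>(w ` I)"
  proof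
    fix x assume "x \<in> \<Union>\<G>"
    then obtain U where U: "U \<in> \<G>" "x \<in> U" by auto
    then obtain e where e: "e > 0" "ball x e \<subseteq> U"
      using op open_contains_ball by metis
    obtain d where d: "d \<in> D" "dist d x < e / 3"
      using D(2) e(1) by (metis UNIV_I closure_approachable divide_pos_pos zero_less_numeral)
    \<comment> \<open>A radius above \<open>e / 3\<close> captures \<open>x\<close>; a radius below
      \<open>2 * e / 3\<close>, added to the distance of the centres, stays within
      \<open>e\<close>.\<close>
    obtain r where r: "r \<in> \<rat>" "e / 3 < r" "r < 2 * e / 3"
      using Rats_dense_in_real[of "e / 3" "2 * e / 3"] e(1) by auto
    have "ball d r \<subseteq> ball x e"
      using d(2) r(3) by (auto simp: subset_iff dist_commute) (smt (verit) dist_commute dist_triangle)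
    then have "(d, r) \<in> I" using d(1) r(1) U(1) e(2) by (auto simp: I_def)
    moreover have "x \<in> ball d r" using d(2) r(2) by auto
    ultimately show "x \<in> \<Union>(w ` I)" using w(2) by fastforce
  qed
  ultimately show ?thesis
    using that[of "w ` I"] w(1) by blast
qed


lemma lsc_cmult:
  assumes "lsc f" "0 < c" shows "lsc (\<lambda>x. c * f x)"
proof -
  have "{x. b < c * f x} = {x. b / c < f x}" for b
    using assms(2) by (auto simp: field_simps)
  then show ?thesis using assms(1) by (auto simp: lsc_def)
qed

lemma lsc_indicator:
  assumes "open U" shows "lsc (indicator U :: _ \<Rightarrow> real)"
proof -
  have "{x. b < (indicator U x :: real)} = (if b < 0 then UNIV else if b < 1 then U else {})" for b
    by (auto simp: indicator_def)
  then show ?thesis using assms by (auto simp: lsc_def)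
qed

text \<open>The pointwise supremum of all lower semicontinuous almost everywhere minorants.
  Maximality and semicontinuity are immediate; the point is that a supremum of uncountably many
  functions is still almost everywhere below \<open>h\<close>, although each of them has its own
  null set.\<close>

lemma greatest_lsc_minorant:
  fixes M :: "'a::metric_space measure"
  assumes M: "sets M = sets borel"
    and supp: "\<And>U. open U \<Longrightarrow> U \<noteq> {} \<Longrightarrow> emeasure M U > 0"
    and sep: "separable_space (euclidean :: 'a topology)"
    and h: "bpos h"
  obtains u where "lsc u" "bpos u" "AE x in M. u x \<le> h x"
    "\<And>f x. lsc f \<Longrightarrow> bpos f \<Longrightarrow> AE x in M. f x \<le> h x \<Longrightarrow> f x \<le> u x"
proof -
  define F where "F = {f. lsc f \<and> bpos f \<and> (AE x in M. f x \<le> h x)}"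
  define u where "u x = (SUP f\<in>F. f x)" for x
  obtain C where C: "\<And>x. h x \<le> C" "0 < C" using bpos_bound[OF h] by metis
  \<comment> \<open>If \<open>f\<close> exceeded \<open>C\<close> anywhere, the open set where it
    does would have positive measure, contradicting \<open>f \<le> h \<le> C\<close> almost
    everywhere. This also makes the real-valued supremum well defined.\<close>
  have le_C: "f x \<le> C" if "f \<in> F" for f x
  proof (rule ccontr)
    assume "\<not> f x \<le> C"
    then have ne: "{x. C < f x} \<noteq> {}" by (auto simp: not_le)
    have op: "open {x. C < f x}" using that by (auto simp: F_def lsc_def)
    have "AE x in M. f x \<le> h x" using that by (simp add: F_def)
    then have "AE x in M. x \<notin> {x. C < f x}"
      by eventually_elim (use C(1) in \<open>auto simp: not_less intro: order_trans\<close>)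
    then have "emeasure M {x. C < f x} = 0"
      using op M by (subst (asm) AE_iff_measurable[where N="{x. C < f x}"])
        (auto dest: sets_eq_imp_space_eq)
    with supp[OF op ne] show False by simp
  qed
  have zero: "(\<lambda>_. 0) \<in> F"
    using bposD(2)[OF h] by (auto simp: F_def lsc_def bpos_const)
  have bdd: "bdd_above ((\<lambda>f. f x) ` F)" for x
    using le_C by (auto intro!: bdd_aboveI[of _ C])
  have ub: "f x \<le> u x" if "f \<in> F" for f x
    unfolding u_def by (rule cSUP_upper[OF that bdd])
  have level: "{x. c < u x} = (\<Union>f\<in>F. {x. c < f x})" for c
    unfolding u_def using zero bdd by (subst less_cSUP_iff) auto
  have lsc: "lsc u"
    unfolding lsc_def level by (auto simp: F_def lsc_def)
  have u_C: "u x \<le> C" for x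
    unfolding u_def using zero le_C by (intro cSUP_least) auto
  have bpos: "bpos u"
    using ub[OF zero] u_C by (intro bposI[of _ C] lsc_measurable lsc)
  \<comment> \<open>By Lindelof the level set \<open>{q < u}\<close> is covered by countably many
    \<open>{q < f}\<close>, and on each of them \<open>h\<close> exceeds \<open>q\<close> off a null
    set. Rational \<open>q\<close> then separate \<open>h x\<close> from \<open>u x\<close>.\<close>
  have "AE x in M. q < u x \<longrightarrow> q \<le> h x" for q
  proof -
    obtain \<G> where \<G>: "countable \<G>" "\<G> \<subseteq> (\<lambda>f. {x. q < f x}) ` F" "\<Union>\<G> = {x. q < u x}"
      unfolding level
      by (rule separable_countable_subcover[OF sep, of "(\<lambda>f. {x. q < f x}) ` F"])
        (auto simp: F_def lsc_def)
    have "AE x in M. x \<in> U \<longrightarrow> q \<le> h x" if "U \<in> \<G>" for U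
    proof -
      obtain f where "f \<in> F" "U = {x. q < f x}" using \<G>(2) \<open>U \<in> \<G>\<close> by auto
      then have "AE x in M. f x \<le> h x" by (simp add: F_def)
      then show ?thesis
        by eventually_elim (use \<open>U = _\<close> in auto)
    qed
    then have "AE x in M. \<forall>U\<in>\<G>. x \<in> U \<longrightarrow> q \<le> h x"
      by (subst AE_ball_countable[OF \<G>(1)]) blast
    then show ?thesis
      by eventually_elim (use \<G>(3) in blast)
  qed
  then have "AE x in M. \<forall>q\<in>\<rat>. q < u x \<longrightarrow> q \<le> h x"
    by (subst AE_ball_countable[OF countable_rat]) blast
  then have "AE x in M. u x \<le> h x"
  proof eventually_elim
    case (elim x)
    show ?case
    proof (rule ccontr)
      assume "\<not> u x \<le> h x"
      then obtain q where "q \<in> \<rat>" "h x < q" "q < u x"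
        using Rats_dense_in_real[of "h x" "u x"] by auto
      with elim show False by auto
    qed
  qed
  then show ?thesis
    using ub by (intro that[OF lsc bpos]) (auto simp: F_def)
qed

text \<open>Cauchy's exponential equation. The regularity it needs comes from the bound by 1, which
  makes \<open>\<theta>\<close> nonincreasing; a single positive value excludes the zero
  solution.\<close>

lemma multiplicative_eq_powr:
  fixes \<theta> :: "real \<Rightarrow> real"
  assumes mult: "\<And>s t. 0 \<le> s \<Longrightarrow> 0 \<le> t \<Longrightarrow> \<theta> (s + t) = \<theta> s * \<theta> t"
    and nonneg: "\<And>t. 0 \<le> t \<Longrightarrow> 0 \<le> \<theta> t" and le1: "\<And>t. 0 \<le> t \<Longrightarrow> \<theta> t \<le> 1"
    and t1: "0 < t1" "0 < \<theta> t1" and t: "0 \<le> t"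
  shows "0 < \<theta> t" "\<theta> t = \<theta> 1 powr t"
proof -
  have "\<theta> 0 * \<theta> t1 = \<theta> t1" using mult[of 0 t1] t1 by simp
  then have "\<theta> 0 = 1" using t1(2) by simp
  have pow: "\<theta> (real n * s) = \<theta> s ^ n" if "0 \<le> s" for n s
    using that by (induction n) (simp_all add: \<open>\<theta> 0 = 1\<close> distrib_right mult)
  have anti: "\<theta> s' \<le> \<theta> s" if "0 \<le> s" "s \<le> s'" for s s'
    using mult[of s "s' - s"] nonneg[of s] le1[of "s' - s"] that mult_left_mono[of "\<theta> (s' - s)" 1 "\<theta> s"]
    by simp
  have pos: "0 < \<theta> s" if "0 \<le> s" for s
  proof -
    obtain n :: nat where "s / t1 < n" using reals_Archimedean2 by blast
    then have "s \<le> real n * t1" using t1(1) by (simp add: field_simps)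
    moreover have "0 < \<theta> (real n * t1)" using t1 by (simp add: pow)
    ultimately show ?thesis using anti[of s "real n * t1"] that by linarith
  qed
  then show "0 < \<theta> t" using t by simp
  define L where "L s = - ln (\<theta> s)" for s
  have L_mono: "L s \<le> L s'" if "0 \<le> s" "s \<le> s'" for s s'
    using anti[OF that] pos[of s] pos[of s'] that by (simp add: L_def)
  have L_pow: "L (real n * s) = real n * L s" if "0 \<le> s" for n s
    using that pos by (simp add: L_def pow ln_realpow)
  \<comment> \<open>With \<open>k\<close> the integer part of \<open>n * t\<close>, both
    \<open>n * L t\<close> and \<open>n * t * L 1\<close> lie between \<open>k * L 1\<close> and
    \<open>(k + 1) * L 1\<close>; letting \<open>n\<close> grow forces equality.\<close>
  have "real n * \<bar>L t - t * L 1\<bar> \<le> L 1" for n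
  proof -
    define k where "k = nat \<lfloor>real n * t\<rfloor>"
    have "real k = of_int \<lfloor>real n * t\<rfloor>" using t by (simp add: k_def)
    then have k: "real k \<le> real n * t" "real n * t \<le> real (Suc k)"
      using of_int_floor_le[of "real n * t"] real_of_int_floor_add_one_ge[of "real n * t"]
      by linarith+
    have L1: "0 \<le> L 1" using le1[of 1] pos[of 1] by (simp add: L_def)
    have "real k * L 1 \<le> real n * L t"
      using L_mono[OF _ k(1)] L_pow[of 1 k] L_pow[OF t, of n] by simp
    moreover have "real n * L t \<le> real (Suc k) * L 1"
      using L_mono[OF _ k(2)] L_pow[of 1 "Suc k"] L_pow[OF t, of n] t by simp
    moreover have "real k * L 1 \<le> real n * t * L 1" "real n * t * L 1 \<le> real (Suc k) * L 1"
      using k L1 by (auto intro!: mult_right_mono simp del: of_nat_Suc)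
    ultimately have "\<bar>real n * (L t - t * L 1)\<bar> \<le> L 1"
      by (simp add: abs_le_iff algebra_simps)
    then show ?thesis by (simp add: abs_mult)
  qed
  then have "L t = t * L 1"
    by (metis abs_le_zero_iff abs_ge_zero eq_iff_diff_eq_0 linorder_not_le mult.commute
        reals_Archimedean3)
  then have "ln (\<theta> t) = t * ln (\<theta> 1)" by (simp add: L_def)
  then have "exp (ln (\<theta> t)) = \<theta> 1 powr t"
    using pos[of 1] by (simp add: powr_def)
  then show "\<theta> t = \<theta> 1 powr t"
    using pos[OF t] by simp
qed

section \<open>Duality and almost everywhere eigenfunctions\<close>

text \<open>Assumption (E) with its witnesses fixed: \<open>Q\<close> is the dual semigroup and
  \<open>\<pi>\<close> its QSD. The conditional law in \<open>doeblin\<close> is a quotient of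
  masses, whose denominator is positive by \<open>survive\<close>.\<close>

locale assumption_E =
  fixes \<Lambda> :: "'a::metric_space measure"
    and P Q :: "real \<Rightarrow> 'a \<Rightarrow> 'a measure"
    and \<psi> :: "'a \<Rightarrow> real"
    and a c0 t0 c1 t1 :: real
    and \<nu> \<pi> :: "'a measure"
    and \<O> :: "'a set"
  assumes Lambda_sets: "sets \<Lambda> = sets borel"
    and Lambda_sigma: "sigma_finite_measure \<Lambda>"
    and Lambda_support: "\<And>U. open U \<Longrightarrow> U \<noteq> {} \<Longrightarrow> emeasure \<Lambda> U > 0"
    and P_sg: "submarkov_semigroup P"
    and separable: "separable_space (euclidean :: 'a topology)"
    and survive: "\<And>x t. 0 \<le> t \<Longrightarrow> measure (P t x) UNIV > 0"
    and c0_pos: "c0 > 0" and t0_pos: "t0 > 0"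
    and nu_prob: "prob_space \<nu>" and nu_sets: "sets \<nu> = sets borel"
    and doeblin: "\<And>x A. A \<in> sets borel \<Longrightarrow>
                    measure (P t0 x) A / measure (P t0 x) UNIV \<ge> c0 * measure \<nu> A"
    and P_lsc: "\<And>t. 0 \<le> t \<Longrightarrow> lsc_kernel (P t)"
    and psi: "Cb_pos \<psi>"
    and a_pos: "a > 0"
    and Q_sg: "submarkov_semigroup Q"
    and duality: "\<And>t A B. 0 \<le> t \<Longrightarrow> A \<in> sets borel \<Longrightarrow> B \<in> sets borel \<Longrightarrow>
        (\<integral>\<^sup>+ x\<in>A. ennreal (\<psi> x) * emeasure (P t x) B \<partial>\<Lambda>)
        = ennreal (a powr t) * (\<integral>\<^sup>+ y\<in>B. ennreal (\<psi> y) * emeasure (Q t y) A \<partial>\<Lambda>)"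
    and pi_QSD: "is_QSD Q \<pi>"
    and pi_Pinf: "P_infty \<Lambda> \<pi>"
    and O_open: "open \<O>"
    and c1_pos: "c1 > 0" and t1_pos: "t1 > 0"
    and pi_lower: "\<And>A. A \<in> sets borel \<Longrightarrow> emeasure \<pi> A \<ge> ennreal c1 * emeasure \<Lambda> (A \<inter> \<O>)"
    and nu_reach: "(\<integral>\<^sup>+ x. emeasure (P t1 x) \<O> \<partial>\<nu>) > 0"
begin

lemmas P_kernel = semigroup_kernel[OF P_sg] and Q_kernel = semigroup_kernel[OF Q_sg]

lemma Lambda_space [simp]: "space \<Lambda> = UNIV" and nu_space [simp]: "space \<nu> = UNIV"
  using sets_eq_imp_space_eq[OF Lambda_sets] sets_eq_imp_space_eq[OF nu_sets] by auto

lemma Lambda_measurable: "f \<in> \<Lambda> \<rightarrow>\<^sub>M N \<longleftrightarrow> f \<in> borel \<rightarrow>\<^sub>M N"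
  by (simp only: measurable_cong_sets[OF Lambda_sets refl])

lemma nu_integrable: "bpos f \<Longrightarrow> integrable \<nu> f"
  using nu_prob by (intro integrable_bpos nu_sets) (auto simp: prob_space_def)

lemma nu_mono: "bpos f \<Longrightarrow> bpos g \<Longrightarrow> (\<And>x. f x \<le> g x) \<Longrightarrow> (\<integral>x. f x \<partial>\<nu>) \<le> (\<integral>x. g x \<partial>\<nu>)"
  by (intro integral_mono nu_integrable)

lemma P_semigroup:
  "0 \<le> s \<Longrightarrow> 0 \<le> t \<Longrightarrow> bpos f \<Longrightarrow> kact (P (s + t)) f x = kact (P s) (kact (P t) f) x"
  by (rule kact_semigroup[OF P_sg])

lemma psi_bounds:
  obtains l B where "0 < l" "\<And>x. l \<le> \<psi> x" "\<And>x. \<psi> x \<le> B" "0 < B"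
proof -
  obtain l where l: "0 < l" "\<And>x. l \<le> \<psi> x" using psi by (auto simp: Cb_pos_def)
  obtain B where B: "\<forall>y\<in>range \<psi>. norm y \<le> B"
    using psi unfolding Cb_pos_def bounded_iff by blast
  then have "\<psi> x \<le> B" for x by (simp add: abs_le_iff)
  with l show ?thesis using that by (meson less_le_trans)
qed

lemma psi_measurable [measurable]: "\<psi> \<in> borel_measurable borel"
  using psi by (auto simp: Cb_pos_def intro: borel_measurable_continuous_onI)

text \<open>For fixed \<open>A\<close>, the duality says that two measures in \<open>B\<close>
  coincide, namely the image under \<open>P t\<close> of \<open>\<psi> \<Lambda>\<close> restricted
  to \<open>A\<close>, and a density with respect to \<open>\<Lambda>\<close>. Integrating
  \<open>f\<close> against both gives the claim; \<open>A\<close> stays free as a test set for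
  comparing densities.\<close>

lemma duality_nn_integral:
  assumes t: "0 \<le> t" and A: "A \<in> sets borel" and f: "f \<in> borel_measurable borel"
  shows "(\<integral>\<^sup>+ x\<in>A. ennreal (\<psi> x) * (\<integral>\<^sup>+ y. f y \<partial>P t x) \<partial>\<Lambda>)
    = ennreal (a powr t) * (\<integral>\<^sup>+ y. ennreal (\<psi> y) * emeasure (Q t y) A * f y \<partial>\<Lambda>)"
proof -
  note [measurable] = A f kernel_measurable[OF P_kernel[OF t]]
  have [measurable]: "(\<lambda>y. emeasure (Q t y) B) \<in> borel_measurable borel" if "B \<in> sets borel" for B
    by (rule measurable_emeasure_kernel[OF kernel_measurable[OF Q_kernel[OF t]] that])
  have [measurable]: "(\<lambda>x. \<integral>\<^sup>+ y. f y \<partial>P t x) \<in> borel_measurable borel"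
    by (rule measurable_compose[OF kernel_measurable[OF P_kernel[OF t]]
          nn_integral_measurable_subprob_algebra[OF f]])
  have [measurable]: "(\<lambda>x. emeasure (P t x) B) \<in> borel_measurable borel" if "B \<in> sets borel" for B
    by (rule measurable_emeasure_kernel[OF kernel_measurable[OF P_kernel[OF t]] that])
  define M1 where "M1 = density \<Lambda> (\<lambda>x. ennreal (\<psi> x) * indicator A x) \<bind> P t"
  define M2 where "M2 = density \<Lambda> (\<lambda>y. ennreal (a powr t) * (ennreal (\<psi> y) * emeasure (Q t y) A))"
  have mP: "P t \<in> density \<Lambda> (\<lambda>x. ennreal (\<psi> x) * indicator A x) \<rightarrow>\<^sub>M subprob_algebra borel"
    using kernel_measurable[OF P_kernel[OF t]] by (simp add: Lambda_measurable)
  have "M1 = M2"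
  proof (rule measure_eqI)
    show "sets M1 = sets M2"
      unfolding M1_def M2_def
      by (subst sets_bind[where N=borel]) (auto simp: kernel_sets[OF P_kernel] t Lambda_sets)
    fix B assume "B \<in> sets M1"
    then have B [measurable]: "B \<in> sets borel"
      unfolding M1_def
      by (subst (asm) sets_bind[where N=borel]) (auto simp: kernel_sets[OF P_kernel] t)
    have "emeasure M1 B = (\<integral>\<^sup>+ x\<in>A. ennreal (\<psi> x) * emeasure (P t x) B \<partial>\<Lambda>)"
      unfolding M1_def
      by (subst emeasure_bind[OF _ mP B], simp, subst nn_integral_density)
        (simp_all add: Lambda_measurable ac_simps)
    also have "\<dots> = emeasure M2 B"
      unfolding M2_def duality[OF t A B]
      by (subst emeasure_density) (simp_all add: Lambda_sets Lambda_measurable nn_integral_cmult[symmetric] ac_simps)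
    finally show "emeasure M1 B = emeasure M2 B" .
  qed
  have "(\<integral>\<^sup>+ x\<in>A. ennreal (\<psi> x) * (\<integral>\<^sup>+ y. f y \<partial>P t x) \<partial>\<Lambda>) = (\<integral>\<^sup>+ y. f y \<partial>M1)"
    unfolding M1_def
    by (subst nn_integral_bind[OF f mP], subst nn_integral_density)
      (simp_all add: Lambda_measurable ac_simps)
  also have "\<dots> = (\<integral>\<^sup>+ y. f y \<partial>M2)" by (simp add: \<open>M1 = M2\<close>)
  also have "\<dots> = ennreal (a powr t) * (\<integral>\<^sup>+ y. ennreal (\<psi> y) * emeasure (Q t y) A * f y \<partial>\<Lambda>)"
    unfolding M2_def
    by (subst nn_integral_density) (simp_all add: Lambda_measurable nn_integral_cmult[symmetric] ac_simps)
  finally show ?thesis .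
qed

text \<open>\<open>\<Lambda>\<close>, moved by \<open>P t\<close>, stays absolutely continuous: for
  a null set \<open>N\<close> the dual side of the duality integrates over \<open>N\<close> and
  vanishes, and \<open>\<psi>\<close> is positive.\<close>

lemma AE_P:
  assumes t: "0 \<le> t" and R: "AE x in \<Lambda>. R x"
  shows "AE x in \<Lambda>. AE y in P t x. R y"
proof -
  obtain N where N: "{x \<in> space \<Lambda>. \<not> R x} \<subseteq> N" "emeasure \<Lambda> N = 0" "N \<in> sets \<Lambda>"
    using R by (rule AE_E)
  then have Nb [measurable]: "N \<in> sets borel" by (simp add: Lambda_sets)
  have [measurable]: "(\<lambda>x. emeasure (P t x) N) \<in> borel_measurable borel"
    by (rule measurable_emeasure_kernel[OF kernel_measurable[OF P_kernel[OF t]] Nb])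
  have "AE y in \<Lambda>. y \<notin> N" using N by (intro AE_not_in) (auto simp: null_sets_def)
  then have "AE y in \<Lambda>. ennreal (\<psi> y) * emeasure (Q t y) UNIV * indicator N y = 0"
    by eventually_elim (simp add: indicator_def)
  then have "(\<integral>\<^sup>+ y. ennreal (\<psi> y) * emeasure (Q t y) UNIV * indicator N y \<partial>\<Lambda>) = 0"
    using nn_integral_cong_AE by fastforce
  then have "(\<integral>\<^sup>+ x. ennreal (\<psi> x) * emeasure (P t x) N \<partial>\<Lambda>) = 0"
    using duality[OF t, of UNIV N] Nb by simp
  then have "AE x in \<Lambda>. ennreal (\<psi> x) * emeasure (P t x) N = 0"
    by (rule nn_integral_0_iff_AE[THEN iffD1, rotated]) (simp add: Lambda_measurable)
  then show ?thesis
  proof eventually_elim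
    case (elim x)
    obtain l where "0 < l" "\<And>x. l \<le> \<psi> x" using psi_bounds by metis
    then have "0 < \<psi> x" by (meson less_le_trans)
    with elim have "emeasure (P t x) N = 0" by simp
    then show "AE y in P t x. R y"
      using N(1) Nb by (intro AE_I[of _ _ N]) (auto simp: kernel_sets[OF P_kernel[OF t]])
  qed
qed

lemma AE_kact_mono:
  assumes t: "0 \<le> t" and "bpos f" "bpos g" "AE x in \<Lambda>. f x \<le> g x"
  shows "AE x in \<Lambda>. kact (P t) f x \<le> kact (P t) g x"
  using AE_P[OF t assms(4)]
proof eventually_elim
  case (elim x)
  then show ?case
    unfolding kact_def
    by (intro integral_mono_AE kernel_integrable[OF P_kernel[OF t]] assms)
qed

lemma AE_kact_cong:
  assumes t: "0 \<le> t" and "bpos f" "bpos g" "AE x in \<Lambda>. f x = g x"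
  shows "AE x in \<Lambda>. kact (P t) f x = kact (P t) g x"
proof -
  have "AE x in \<Lambda>. kact (P t) f x \<le> kact (P t) g x" "AE x in \<Lambda>. kact (P t) g x \<le> kact (P t) f x"
    by (rule AE_kact_mono[OF t]; use assms in \<open>auto elim: eventually_mono\<close>)+
  then show ?thesis by eventually_elim simp
qed

text \<open>If \<open>B\<close> is null, then \<open>P t0 x\<close> gives no mass to
  \<open>B\<close> for almost every \<open>x\<close>, and \<open>doeblin\<close> at one such
  \<open>x\<close> gives \<open>\<nu>\<close> no mass there either. Almost everywhere inequalities
  may thus be integrated against \<open>\<nu>\<close>.\<close>

lemma nu_abs_cont: "absolutely_continuous \<Lambda> \<nu>"
  unfolding absolutely_continuous_def
proof
  fix B assume B: "B \<in> null_sets \<Lambda>"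
  then have Bb: "B \<in> sets borel" by (auto simp: Lambda_sets)
  have "AE y in \<Lambda>. y \<notin> B" using B by (rule AE_not_in)
  then have "AE x in \<Lambda>. AE y in P t0 x. y \<notin> B"
    using t0_pos by (intro AE_P) auto
  then have "AE x in \<Lambda>. measure \<nu> B = 0"
  proof eventually_elim
    case (elim x)
    have "B \<in> null_sets (P t0 x)"
      using elim Bb t0_pos by (subst AE_iff_null_sets) (auto simp: kernel_sets[OF P_kernel])
    then have "measure (P t0 x) B = 0" by (simp add: measure_eq_0_null_sets)
    then show ?case
      using doeblin[OF Bb, of x] c0_pos by (simp add: mult_le_0_iff measure_le_0_iff)
  qed
  \<comment> \<open>The assertion no longer depends on \<open>x\<close>, so it suffices that
    \<open>\<Lambda>\<close> is not the zero measure.\<close>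
  then have "measure \<nu> B = 0"
    using Lambda_support[of UNIV] ae_filter_eq_bot_iff[of \<Lambda>] by (simp add: eventually_const)
  then show "B \<in> null_sets \<nu>"
    using nu_prob Bb by (auto simp: null_sets_def nu_sets finite_measure.emeasure_eq_measure prob_space_def)
qed

lemma AE_nu: "AE x in \<Lambda>. R x \<Longrightarrow> AE x in \<nu>. R x"
  by (rule absolutely_continuous_AE[OF _ nu_abs_cont]) (auto simp: nu_sets Lambda_sets)

text \<open>The minorisation read as an inequality between the measures \<open>r \<nu>\<close> and
  \<open>P t0 x\<close>, then integrated.\<close>

lemma doeblin_kact:
  assumes f: "bpos f"
  shows "c0 * (\<integral>y. f y \<partial>\<nu>) * kact (P t0) (\<lambda>_. 1) x \<le> kact (P t0) f x"
proof -
  note K = P_kernel[OF less_imp_le[OF t0_pos]]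
  have pos: "0 < kact (P t0) (\<lambda>_. 1) x"
    using survive[of t0 x] t0_pos by (simp add: kact_const[OF K])
  define r where "r = c0 * kact (P t0) (\<lambda>_. 1) x"
  have r: "0 < r" using pos c0_pos by (simp add: r_def)
  have "scale_measure (ennreal r) \<nu> \<le> P t0 x"
  proof (rule less_eq_measure.intros(3))
    show "space (scale_measure (ennreal r) \<nu>) = space (P t0 x)"
      by (simp add: kernel_space[OF K] space_scale_measure)
    show "sets (scale_measure (ennreal r) \<nu>) = sets (P t0 x)"
      by (simp add: kernel_sets[OF K] nu_sets)
    have "ennreal r * emeasure \<nu> A \<le> emeasure (P t0 x) A" for A
    proof (cases "A \<in> sets borel")
      case True
      then have "r * measure \<nu> A \<le> measure (P t0 x) A"
        using doeblin[OF True, of x] pos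
        by (simp add: r_def kact_const[OF K] field_simps)
      then show ?thesis
        using nu_prob kernel_finite[OF K, of x] r
        by (simp add: finite_measure.emeasure_eq_measure prob_space_def ennreal_mult[symmetric])
    qed (simp add: emeasure_notin_sets nu_sets kernel_sets[OF K])
    then show "emeasure (scale_measure (ennreal r) \<nu>) \<le> emeasure (P t0 x)"
      by (simp add: le_fun_def)
  qed
  then have "(\<integral>\<^sup>+ y. ennreal (f y) \<partial>scale_measure (ennreal r) \<nu>) \<le> (\<integral>\<^sup>+ y. ennreal (f y) \<partial>P t0 x)"
    by (intro nn_integral_mono_measure) (simp_all add: kernel_sets[OF K] nu_sets)
  also have "\<dots> = ennreal (kact (P t0) f x)" by (simp add: ennreal_kact[OF K f])
  also have "(\<integral>\<^sup>+ y. ennreal (f y) \<partial>scale_measure (ennreal r) \<nu>) = ennreal r * (\<integral>\<^sup>+ y. ennreal (f y) \<partial>\<nu>)"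
    using bposD(1)[OF f] nu_sets by (intro nn_integral_scale_measure) (simp cong: measurable_cong_sets)
  also have "(\<integral>\<^sup>+ y. ennreal (f y) \<partial>\<nu>) = ennreal (\<integral>y. f y \<partial>\<nu>)"
    using bposD(2)[OF f] by (intro nn_integral_eq_integral nu_integrable f) auto
  finally have "ennreal (r * (\<integral>y. f y \<partial>\<nu>)) \<le> ennreal (kact (P t0) f x)"
    using r bposD(2)[OF f] by (simp add: ennreal_mult integral_nonneg_AE)
  then show ?thesis
    using kact_nonneg[OF K f] by (simp add: r_def ac_simps)
qed

section \<open>The eigenvalue and an almost everywhere eigenfunction\<close>

definition eigenvalue :: "real \<Rightarrow> real" where
  "eigenvalue t = a powr t * (\<integral>y. measure (Q t y) UNIV \<partial>\<pi>)"

lemma pi_prob: "prob_space \<pi>" and pi_sets: "sets \<pi> = sets borel"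
  using pi_QSD by (auto simp: is_QSD_def)

lemma mass_bpos:
  assumes "0 \<le> t" shows "bpos (\<lambda>y. measure (Q t y) UNIV)"
proof -
  have "kact (Q t) (\<lambda>_. 1) = (\<lambda>y. measure (Q t y) UNIV)"
    by (rule ext) (simp add: kact_const[OF Q_kernel[OF assms]])
  then show ?thesis
    using kact_bpos[OF Q_kernel[OF assms] bpos_const[of 1]] by simp
qed

lemma mass_le_1: "0 \<le> t \<Longrightarrow> measure (Q t y) UNIV \<le> 1"
  using subprob_space.subprob_measure_le_1[OF kernel_subprob[OF Q_kernel]] .

lemma pi_integrable: "bpos f \<Longrightarrow> integrable \<pi> f"
  using pi_prob by (intro integrable_bpos pi_sets) (auto simp: prob_space_def)

lemma pi_mass_bounds:
  assumes "0 \<le> t"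
  shows "0 \<le> (\<integral>y. measure (Q t y) UNIV \<partial>\<pi>)" "(\<integral>y. measure (Q t y) UNIV \<partial>\<pi>) \<le> 1"
proof -
  show "0 \<le> (\<integral>y. measure (Q t y) UNIV \<partial>\<pi>)" by (simp add: integral_nonneg_AE)
  have "(\<integral>y. measure (Q t y) UNIV \<partial>\<pi>) \<le> (\<integral>y. 1 \<partial>\<pi>)"
    by (intro integral_mono pi_integrable mass_bpos bpos_const mass_le_1 assms) simp
  then show "(\<integral>y. measure (Q t y) UNIV \<partial>\<pi>) \<le> 1"
    using prob_space.prob_space[OF pi_prob] by simp
qed

lemma pi_QSD_emeasure:
  assumes t: "0 \<le> t" and A: "A \<in> sets borel"
  shows "(\<integral>\<^sup>+ y. emeasure (Q t y) A \<partial>\<pi>)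
    = ennreal (\<integral>y. measure (Q t y) UNIV \<partial>\<pi>) * emeasure \<pi> A"
proof -
  have "(\<integral>\<^sup>+ y. emeasure (Q t y) UNIV \<partial>\<pi>) = (\<integral>\<^sup>+ y. ennreal (measure (Q t y) UNIV) \<partial>\<pi>)"
    by (simp add: finite_measure.emeasure_eq_measure[OF kernel_finite[OF Q_kernel[OF t]]])
  also have "\<dots> = ennreal (\<integral>y. measure (Q t y) UNIV \<partial>\<pi>)"
    by (intro nn_integral_eq_integral pi_integrable mass_bpos t) simp
  finally have mass: "(\<integral>\<^sup>+ y. emeasure (Q t y) UNIV \<partial>\<pi>) = ennreal (\<integral>y. measure (Q t y) UNIV \<partial>\<pi>)" .
  have "(\<integral>\<^sup>+ y. emeasure (Q t y) A \<partial>\<pi>) = (\<integral>\<^sup>+ y. emeasure (Q t y) UNIV \<partial>\<pi>) * emeasure \<pi> A"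
    using pi_QSD t A unfolding is_QSD_def by blast
  then show ?thesis unfolding mass .
qed

text \<open>\<open>h\<close> is the density of \<open>\<pi>\<close> divided by
  \<open>\<psi>\<close>, which cancels the weight in the duality. The lower bound on
  \<open>\<O>\<close> will keep the integrals of \<open>h\<close> and of its minorant against
  \<open>\<nu>\<close> positive.\<close>

lemma AE_eigenfunction:
  obtains h c where "bpos h" "0 < c" "AE x in \<Lambda>. c * indicator \<O> x \<le> h x"
    "\<And>t. 0 \<le> t \<Longrightarrow> AE x in \<Lambda>. kact (P t) h x = eigenvalue t * h x"
proof -
  obtain g where g: "g \<in> borel_measurable borel" "\<And>x. 0 \<le> g x" "bounded (range g)"
    "\<pi> = density \<Lambda> (\<lambda>x. ennreal (g x))"
    using pi_Pinf by (auto simp: P_infty_def)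
  note [measurable] = g(1)
  have "bpos g" using g by (simp add: bpos_def)
  then obtain G where G: "\<And>x. g x \<le> G" "0 < G" using bpos_bound by metis
  obtain l B where psi_b: "0 < l" "\<And>x. l \<le> \<psi> x" "\<And>x. \<psi> x \<le> B" "0 < B"
    using psi_bounds by metis
  have psi_pos: "0 < \<psi> x" for x using psi_b by (meson less_le_trans)
  define h where "h x = g x / \<psi> x" for x
  have h: "bpos h"
  proof (rule bposI[of _ "G / l"])
    show "h x \<le> G / l" for x
      unfolding h_def using G g(2) psi_b by (intro frac_le) auto
  qed (use g(2) psi_pos in \<open>auto simp: h_def[abs_def] less_imp_le\<close>)
  have "AE x in \<Lambda>. c1 * indicator \<O> x \<le> g x"
  proof -
    \<comment> \<open>On \<open>A n\<close> the density is at most \<open>c1 - 1 / (n + 1)\<close>,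
      while \<open>pi_lower\<close> asks for at least \<open>c1\<close> on average, so
      \<open>A n\<close> is null. The cancellation needs \<open>A n\<close> to have finite measure,
      which holds because \<open>\<pi>\<close> is a probability.\<close>
    define A where "A n = {x \<in> \<O>. g x \<le> c1 - 1 / real (Suc n)}" for n
    have "A n \<in> null_sets \<Lambda>" for n
    proof -
      have A [measurable]: "A n \<in> sets borel"
        unfolding A_def using O_open by measurable
      have sub: "A n \<inter> \<O> = A n" by (auto simp: A_def)
      have low: "ennreal c1 * emeasure \<Lambda> (A n) \<le> emeasure \<pi> (A n)"
        using pi_lower[OF A] by (simp add: sub)
      also have "\<dots> \<le> 1" by (rule prob_space.measure_le_1[OF pi_prob])
      finally have "emeasure \<Lambda> (A n) \<noteq> \<infinity>"
        using c1_pos by (auto simp: ennreal_mult_top top_unique)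
      then obtain m where m: "emeasure \<Lambda> (A n) = ennreal m" "0 \<le> m"
        by (cases "emeasure \<Lambda> (A n)") auto
      have "emeasure \<pi> (A n) = (\<integral>\<^sup>+x. ennreal (g x) * indicator (A n) x \<partial>\<Lambda>)"
        unfolding g(4) using A by (subst emeasure_density) (auto simp: Lambda_measurable Lambda_sets)
      also have "\<dots> \<le> (\<integral>\<^sup>+x. ennreal (max 0 (c1 - 1 / real (Suc n))) * indicator (A n) x \<partial>\<Lambda>)"
        by (intro nn_integral_mono) (auto simp: A_def indicator_def intro!: ennreal_leI)
      also have "\<dots> = ennreal (max 0 (c1 - 1 / real (Suc n)) * m)"
        using A m by (subst nn_integral_cmult_indicator) (auto simp: Lambda_sets ennreal_mult)
      finally have "ennreal (c1 * m) \<le> ennreal (max 0 (c1 - 1 / real (Suc n)) * m)"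
        using low m c1_pos by (simp add: ennreal_mult)
      then have "c1 * m \<le> max 0 (c1 - 1 / real (Suc n)) * m"
        using m by (subst (asm) ennreal_le_iff) auto
      moreover have "max 0 (c1 - 1 / real (Suc n)) < c1" using c1_pos by simp
      ultimately have "m = 0" using m(2) by (metis linorder_not_le mult_le_cancel_right order_le_less)
      then show ?thesis using m A by (auto simp: null_sets_def Lambda_sets)
    qed
    then have "AE x in \<Lambda>. \<forall>n. x \<notin> A n"
      by (auto simp: AE_all_countable intro: AE_not_in)
    then show ?thesis
    proof eventually_elim
      case (elim x)
      show ?case
      proof (cases "x \<in> \<O>")
        case True
        have "c1 \<le> g x"
        proof (rule ccontr)
          assume "\<not> c1 \<le> g x"
          then obtain n where "1 / real (Suc n) < c1 - g x"
            using nat_approx_posE[of "c1 - g x"] by auto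
          moreover have "c1 - 1 / real (Suc n) < g x"
            using elim True by (auto simp: A_def not_le simp del: of_nat_Suc)
          ultimately show False by linarith
        qed
        with True show ?thesis by simp
      qed (simp add: g(2))
    qed
  qed
  then have low: "AE x in \<Lambda>. c1 / B * indicator \<O> x \<le> h x"
  proof eventually_elim
    case (elim x)
    have "c1 / B * indicator \<O> x = (c1 * indicator \<O> x) / B" by simp
    also have "\<dots> \<le> g x / \<psi> x"
      using elim c1_pos psi_b(3) psi_pos g(2) by (intro frac_le) auto
    finally show ?case by (simp add: h_def)
  qed
  have eigen: "AE x in \<Lambda>. kact (P t) h x = eigenvalue t * h x" if t: "0 \<le> t" for t
  proof -
    let ?\<theta> = "\<integral>y. measure (Q t y) UNIV \<partial>\<pi>"
    have [measurable]: "kact (P t) h \<in> borel_measurable borel"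
      by (rule bposD(1)[OF kact_bpos[OF P_kernel[OF t] h]])
    have [measurable]: "h \<in> borel_measurable borel" by (rule bposD(1)[OF h])
    have eig: "0 \<le> eigenvalue t" by (simp add: eigenvalue_def pi_mass_bounds t)
    have gh: "ennreal (\<psi> y) * ennreal (h y) = ennreal (g y)" for y
      using psi_pos[of y] g(2)[of y] by (simp add: h_def ennreal_mult[symmetric])
    \<comment> \<open>Both sides have the same integral over every \<open>A\<close>: duality trades
      \<open>P t\<close> for \<open>Q t\<close> and leaves \<open>\<pi>\<close> as the integrating
      measure, and quasi-stationarity replaces the resulting integral by a multiple of the mass of
      \<open>A\<close> under \<open>\<pi>\<close>.\<close>
    have "AE x in \<Lambda>. ennreal (\<psi> x) * ennreal (kact (P t) h x)
        = ennreal (\<psi> x) * ennreal (eigenvalue t * h x)"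
    proof (rule sigma_finite_measure.density_unique2[OF Lambda_sigma])
      fix A assume "A \<in> sets \<Lambda>"
      then have A [measurable]: "A \<in> sets borel" by (simp add: Lambda_sets)
      have [measurable]: "(\<lambda>y. emeasure (Q t y) A) \<in> borel_measurable borel"
        by (rule measurable_emeasure_kernel[OF kernel_measurable[OF Q_kernel[OF t]] A])
      have "(\<integral>\<^sup>+x\<in>A. ennreal (\<psi> x) * ennreal (kact (P t) h x) \<partial>\<Lambda>)
          = ennreal (a powr t) * (\<integral>\<^sup>+ y. ennreal (\<psi> y) * emeasure (Q t y) A * ennreal (h y) \<partial>\<Lambda>)"
        using duality_nn_integral[OF t A, of h] by (simp add: ennreal_kact[OF P_kernel[OF t] h])
      also have "(\<integral>\<^sup>+ y. ennreal (\<psi> y) * emeasure (Q t y) A * ennreal (h y) \<partial>\<Lambda>)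
          = (\<integral>\<^sup>+ y. ennreal (g y) * emeasure (Q t y) A \<partial>\<Lambda>)"
        by (simp add: gh[symmetric] ac_simps)
      also have "\<dots> = (\<integral>\<^sup>+ y. emeasure (Q t y) A \<partial>\<pi>)"
        unfolding g(4) by (subst nn_integral_density) (simp_all add: Lambda_measurable)
      also have "\<dots> = ennreal ?\<theta> * (\<integral>\<^sup>+ y. ennreal (g y) * indicator A y \<partial>\<Lambda>)"
        unfolding pi_QSD_emeasure[OF t A]
        by (simp add: g(4) emeasure_density Lambda_measurable Lambda_sets A)
      also have "ennreal (a powr t) * \<dots> = ennreal (eigenvalue t) * (\<integral>\<^sup>+ y. ennreal (g y) * indicator A y \<partial>\<Lambda>)"
        by (simp add: eigenvalue_def ennreal_mult pi_mass_bounds t ac_simps)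
      also have "\<dots> = (\<integral>\<^sup>+x. ennreal (eigenvalue t) * (ennreal (g x) * indicator A x) \<partial>\<Lambda>)"
        by (subst nn_integral_cmult) (simp_all add: Lambda_measurable)
      also have "\<dots> = (\<integral>\<^sup>+x\<in>A. ennreal (\<psi> x) * ennreal (eigenvalue t * h x) \<partial>\<Lambda>)"
        using eig bposD(2)[OF h] by (simp add: gh[symmetric] ennreal_mult ac_simps)
      finally show "(\<integral>\<^sup>+x\<in>A. ennreal (\<psi> x) * ennreal (kact (P t) h x) \<partial>\<Lambda>)
          = (\<integral>\<^sup>+x\<in>A. ennreal (\<psi> x) * ennreal (eigenvalue t * h x) \<partial>\<Lambda>)" .
    qed (simp_all add: Lambda_measurable)
    then show ?thesis
    proof eventually_elim
      case (elim x)
      then have "ennreal (\<psi> x * kact (P t) h x) = ennreal (\<psi> x * (eigenvalue t * h x))"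
        using psi_pos[of x] by (simp add: ennreal_mult')
      then show ?case
        using psi_pos[of x] kact_nonneg[OF P_kernel[OF t] h, of x] eig bposD(2)[OF h, of x]
        by (simp add: zero_le_mult_iff)
    qed
  qed
  show ?thesis
    by (rule that[OF h _ low eigen]) (use c1_pos psi_b(4) in simp_all)
qed

lemma nu_P_O_pos: "0 < (\<integral>x. kact (P t1) (indicator \<O>) x \<partial>\<nu>)"
proof -
  have b: "bpos (indicator \<O> :: 'a \<Rightarrow> real)" using O_open by (intro bpos_indicator) simp
  note K = P_kernel[OF less_imp_le[OF t1_pos]]
  have "(\<integral>\<^sup>+ x. emeasure (P t1 x) \<O> \<partial>\<nu>) = (\<integral>\<^sup>+ x. ennreal (kact (P t1) (indicator \<O>) x) \<partial>\<nu>)"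
    using O_open
    by (simp add: finite_measure.emeasure_eq_measure[OF kernel_finite[OF K]] kact_indicator[OF K])
  also have "\<dots> = ennreal (\<integral>x. kact (P t1) (indicator \<O>) x \<partial>\<nu>)"
    by (intro nn_integral_eq_integral nu_integrable kact_bpos[OF K] b) (simp add: kact_nonneg[OF K b])
  finally show ?thesis using nu_reach by simp
qed

lemma nu_AE_mono:
  assumes "bpos f" "bpos g" "AE x in \<Lambda>. f x \<le> g x"
  shows "(\<integral>x. f x \<partial>\<nu>) \<le> (\<integral>x. g x \<partial>\<nu>)"
  by (intro integral_mono_AE nu_integrable AE_nu assms)

text \<open>The semigroup law applied to the almost everywhere eigenfunction makes
  \<open>eigenvalue\<close> multiplicative, once \<open>h\<close> is known to have a nonzero
  integral against \<open>\<nu>\<close> by which to divide.\<close>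

lemma eigenvalue_powr: "0 < eigenvalue 1" "0 \<le> t \<Longrightarrow> eigenvalue t = eigenvalue 1 powr t"
proof -
  obtain h c where h: "bpos h" "0 < c" "AE x in \<Lambda>. c * indicator \<O> x \<le> h x"
    "\<And>t. 0 \<le> t \<Longrightarrow> AE x in \<Lambda>. kact (P t) h x = eigenvalue t * h x"
    using AE_eigenfunction by metis
  have bO: "bpos (indicator \<O> :: 'a \<Rightarrow> real)" using O_open by (intro bpos_indicator) simp
  have eig_nn: "0 \<le> eigenvalue t" if "0 \<le> t" for t
    using that by (simp add: eigenvalue_def pi_mass_bounds)
  note K1 = P_kernel[OF less_imp_le[OF t1_pos]]
  have "AE x in \<Lambda>. c * kact (P t1) (indicator \<O>) x \<le> kact (P t1) h x"
    using AE_kact_mono[OF less_imp_le[OF t1_pos] bpos_cmult[OF bO less_imp_le[OF h(2)]] h(1,3)]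
    by (simp add: kact_cmult)
  with h(4)[OF less_imp_le[OF t1_pos]]
  have "AE x in \<Lambda>. c * kact (P t1) (indicator \<O>) x \<le> eigenvalue t1 * h x"
    by eventually_elim simp
  then have "(\<integral>x. c * kact (P t1) (indicator \<O>) x \<partial>\<nu>) \<le> (\<integral>x. eigenvalue t1 * h x \<partial>\<nu>)"
    using h(1,2) t1_pos eig_nn by (intro nu_AE_mono bpos_cmult kact_bpos[OF K1] bO) auto
  moreover have "0 < (\<integral>x. c * kact (P t1) (indicator \<O>) x \<partial>\<nu>)"
    using nu_P_O_pos h(2) by simp
  \<comment> \<open>One inequality yields both facts needed: \<open>eigenvalue t1\<close> and the
    integral of \<open>h\<close> are nonzero.\<close>
  ultimately have pos: "0 < eigenvalue t1 * (\<integral>x. h x \<partial>\<nu>)" by simp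
  then have eig1: "0 < eigenvalue t1"
    using eig_nn[of t1] t1_pos by (cases "eigenvalue t1 = 0") auto
  have mult: "eigenvalue (s + t) = eigenvalue s * eigenvalue t" if s: "0 \<le> s" and t: "0 \<le> t" for s t
  proof -
    note Kt = P_kernel[OF t]
    have "AE x in \<Lambda>. kact (P s) (kact (P t) h) x = kact (P s) (\<lambda>y. eigenvalue t * h y) x"
      by (intro AE_kact_cong s kact_bpos[OF Kt] bpos_cmult h t eig_nn)
    with h(4)[OF s] h(4)[OF add_nonneg_nonneg[OF s t]]
    have "AE x in \<Lambda>. eigenvalue (s + t) * h x = eigenvalue s * eigenvalue t * h x"
    proof eventually_elim
      case (elim x)
      have "eigenvalue (s + t) * h x = eigenvalue t * kact (P s) h x"
        using elim(2,3) by (simp only: P_semigroup[OF s t h(1)] kact_cmult)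
      then show ?case by (simp only: elim(1) ac_simps)
    qed
    then have eq: "AE x in \<nu>. eigenvalue (s + t) * h x = eigenvalue s * eigenvalue t * h x"
      by (rule AE_nu)
    have m: "h \<in> borel_measurable \<nu>"
      by (rule borel_measurable_integrable[OF nu_integrable[OF h(1)]])
    have "(\<integral>x. eigenvalue (s + t) * h x \<partial>\<nu>) = (\<integral>x. eigenvalue s * eigenvalue t * h x \<partial>\<nu>)"
      by (rule integral_cong_AE[OF _ _ eq]) (intro borel_measurable_times borel_measurable_const m)+
    then have "eigenvalue (s + t) * (\<integral>x. h x \<partial>\<nu>) = eigenvalue s * eigenvalue t * (\<integral>x. h x \<partial>\<nu>)"
      by (simp only: integral_mult_right_zero)
    moreover have "(\<integral>x. h x \<partial>\<nu>) \<noteq> 0" using pos by auto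
    ultimately show ?thesis by (simp only: mult_cancel_right simp_thms)
  qed
  \<comment> \<open>\<open>eigenvalue\<close> may exceed 1 when \<open>a > 1\<close>; dividing out
    the power of \<open>a\<close> leaves a survival probability, bounded by 1 as the Cauchy equation
    requires.\<close>
  define \<theta> where "\<theta> t = (\<integral>y. measure (Q t y) UNIV \<partial>\<pi>)" for t
  have \<theta>: "eigenvalue t = a powr t * \<theta> t" for t by (simp add: \<theta>_def eigenvalue_def)
  have \<theta>_mult: "\<theta> (s + t) = \<theta> s * \<theta> t" if "0 \<le> s" "0 \<le> t" for s t
    using mult[OF that] a_pos by (simp add: \<theta> powr_add)
  have bnd: "0 \<le> \<theta> t" "\<theta> t \<le> 1" if "0 \<le> t" for t
    using pi_mass_bounds[OF that] by (simp_all add: \<theta>_def)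
  have \<theta>1: "0 < \<theta> t1" using eig1 a_pos by (simp add: \<theta> zero_less_mult_iff)
  have pw: "0 < \<theta> t" "\<theta> t = \<theta> 1 powr t" if "0 \<le> t" for t
    using multiplicative_eq_powr[of \<theta> t1 t, OF \<theta>_mult bnd t1_pos \<theta>1 that] by auto
  have "0 < \<theta> 1" by (rule pw(1)) simp
  then show "0 < eigenvalue 1" using a_pos by (simp add: \<theta>)
  assume t: "0 \<le> t"
  have "eigenvalue t = a powr t * \<theta> 1 powr t"
    unfolding \<theta>[of t] by (simp only: pw(2)[OF t])
  also have "\<dots> = eigenvalue 1 powr t"
    using a_pos \<open>0 < \<theta> 1\<close> by (simp add: \<theta>[of 1] powr_mult)
  finally show "eigenvalue t = eigenvalue 1 powr t" .
qed

section \<open>The eigenfunction\<close>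

abbreviation lam :: real where "lam \<equiv> eigenvalue 1"

lemma lam_pos: "0 < lam" by (rule eigenvalue_powr)

text \<open>The greatest lower semicontinuous minorant \<open>u\<close> of an almost everywhere eigenfunction is
  excessive at every point, because \<open>lam powr (-t) * P\<^sub>t u\<close> is again a lower semicontinuous minorant.\<close>

lemma excessive_minorant:
  obtains u where "bpos u" "\<And>t x. 0 \<le> t \<Longrightarrow> kact (P t) u x \<le> lam powr t * u x"
    "0 < (\<integral>x. u x \<partial>\<nu>)"
    "\<exists>\<kappa>>0. \<forall>t\<ge>0. \<kappa> * lam powr t \<le> (\<integral>x. kact (P t) (\<lambda>_. 1) x \<partial>\<nu>)"
proof -
  obtain h c where h: "bpos h" "0 < c" "AE x in \<Lambda>. c * indicator \<O> x \<le> h x"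
    and eig: "\<And>t. 0 \<le> t \<Longrightarrow> AE x in \<Lambda>. kact (P t) h x = eigenvalue t * h x"
    using AE_eigenfunction by metis
  obtain u where u: "lsc u" "bpos u" "AE x in \<Lambda>. u x \<le> h x"
    and max: "\<And>f x. lsc f \<Longrightarrow> bpos f \<Longrightarrow> AE x in \<Lambda>. f x \<le> h x \<Longrightarrow> f x \<le> u x"
    using greatest_lsc_minorant[OF Lambda_sets Lambda_support separable h(1)] by metis
  have bO: "bpos (indicator \<O> :: 'a \<Rightarrow> real)" using O_open by (intro bpos_indicator) simp
  have exc: "kact (P t) u x \<le> lam powr t * u x" if t: "0 \<le> t" for t x
  proof -
    note K = P_kernel[OF t]
    let ?r = "lam powr (-t)"
    have r: "0 < ?r" using lam_pos by simp
    have "AE x in \<Lambda>. kact (P t) u x \<le> kact (P t) h x"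
      by (rule AE_kact_mono[OF t u(2) h(1) u(3)])
    with eig[OF t] have "AE x in \<Lambda>. ?r * kact (P t) u x \<le> h x"
    proof eventually_elim
      case (elim x)
      then have "kact (P t) u x \<le> lam powr t * h x" using eigenvalue_powr(2)[OF t] by metis
      then have "?r * kact (P t) u x \<le> ?r * (lam powr t * h x)"
        using r by (intro mult_left_mono) auto
      then show ?case using lam_pos by (simp add: powr_minus field_simps)
    qed
    then have "?r * kact (P t) u x \<le> u x"
      using r by (intro max lsc_cmult lsc_kact K P_lsc t u bpos_cmult kact_bpos) auto
    then have "lam powr t * (?r * kact (P t) u x) \<le> lam powr t * u x"
      by (intro mult_left_mono) auto
    then show ?thesis using lam_pos by (simp add: powr_minus field_simps)
  qed
  note K1 = P_kernel[OF less_imp_le[OF t1_pos]]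
  \<comment> \<open>As \<open>\<O>\<close> is open, the left side is itself a lower semicontinuous
    minorant. Applying \<open>P t1\<close> and using that \<open>u\<close> is excessive bounds the
    integral of \<open>u\<close> from below.\<close>
  have "c * indicator \<O> x \<le> u x" for x
    using h by (intro max lsc_cmult lsc_indicator O_open bpos_cmult bO) auto
  then have "c * kact (P t1) (indicator \<O>) x \<le> lam powr t1 * u x" for x
    using kact_mono[OF K1 bpos_cmult[OF bO less_imp_le[OF h(2)]] u(2), of x]
      exc[of t1 x] t1_pos by (simp add: kact_cmult)
  then have "(\<integral>x. c * kact (P t1) (indicator \<O>) x \<partial>\<nu>) \<le> (\<integral>x. lam powr t1 * u x \<partial>\<nu>)"
    using h(2) by (intro nu_mono bpos_cmult kact_bpos K1 bO u) auto
  moreover have "0 < (\<integral>x. c * kact (P t1) (indicator \<O>) x \<partial>\<nu>)"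
    using nu_P_O_pos h(2) by simp
  ultimately have "0 < lam powr t1 * (\<integral>x. u x \<partial>\<nu>)" by simp
  then have u_pos: "0 < (\<integral>x. u x \<partial>\<nu>)" by (simp add: zero_less_mult_iff)
  then have h_pos: "0 < (\<integral>x. h x \<partial>\<nu>)"
    using nu_AE_mono[OF u(2) h(1) u(3)] by linarith
  obtain B where B: "\<And>x. h x \<le> B" "0 < B" using bpos_bound[OF h(1)] by metis
  \<comment> \<open>The constant \<open>\<kappa>\<close>: since \<open>h \<le> B\<close>, almost
    everywhere \<open>lam powr t * h\<close> is at most \<open>B\<close> times the survival
    probability; integrate against \<open>\<nu>\<close>.\<close>
  have "(\<integral>x. h x \<partial>\<nu>) / B * lam powr t \<le> (\<integral>x. kact (P t) (\<lambda>_. 1) x \<partial>\<nu>)" if t: "0 \<le> t" for t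
  proof -
    note K = P_kernel[OF t]
    have le: "kact (P t) h x \<le> B * kact (P t) (\<lambda>_. 1) x" for x
      using kact_mono[OF K h(1) bpos_const[of B], of x] B by (simp add: kact_const[OF K])
    have "AE x in \<Lambda>. lam powr t * h x \<le> B * kact (P t) (\<lambda>_. 1) x"
      using eig[OF t]
    proof eventually_elim
      case (elim x)
      then show ?case using le[of x] eigenvalue_powr(2)[OF t] by metis
    qed
    then have "(\<integral>x. lam powr t * h x \<partial>\<nu>) \<le> (\<integral>x. B * kact (P t) (\<lambda>_. 1) x \<partial>\<nu>)"
      using B(2) by (intro nu_AE_mono bpos_cmult kact_bpos[OF K] h bpos_const) auto
    then show ?thesis using B(2) by (simp add: field_simps)
  qed
  then have "\<exists>\<kappa>>0. \<forall>t\<ge>0. \<kappa> * lam powr t \<le> (\<integral>x. kact (P t) (\<lambda>_. 1) x \<partial>\<nu>)"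
    using h_pos B(2) by (intro exI[of _ "(\<integral>x. h x \<partial>\<nu>) / B"]) auto
  then show ?thesis using that[OF u(2) exc u_pos] by blast
qed

section \<open>An everywhere positive eigenfunction\<close>

lemma survival_pos: "0 < kact (P t0) (\<lambda>_. 1) x"
  using survive[of t0 x] t0_pos by (simp add: kact_const[OF P_kernel])

lemma positive_eigenfunction:
  obtains h where "bpos h" "\<And>x. 0 < h x" "\<And>t x. 0 \<le> t \<Longrightarrow> kact (P t) h x = lam powr t * h x"
proof -
  obtain u \<kappa> where u: "bpos u" "\<And>t x. 0 \<le> t \<Longrightarrow> kact (P t) u x \<le> lam powr t * u x"
    "0 < (\<integral>x. u x \<partial>\<nu>)"
    and \<kappa>: "0 < \<kappa>" "\<And>t. 0 \<le> t \<Longrightarrow> \<kappa> * lam powr t \<le> (\<integral>x. kact (P t) (\<lambda>_. 1) x \<partial>\<nu>)"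
    using excessive_minorant by metis
  define U where "U t x = lam powr (-t) * kact (P t) u x" for t x
  have bU: "bpos (U t)" if "0 \<le> t" for t
    unfolding U_def using that by (intro bpos_cmult kact_bpos P_kernel u) auto
  have U_anti: "U t x \<le> U s x" if s: "0 \<le> s" and st: "s \<le> t" for s t x
  proof -
    have r: "0 \<le> t - s" using st by simp
    have "kact (P t) u x = kact (P s) (kact (P (t - s)) u) x"
      using P_semigroup[OF s r u(1), of x] by simp
    also have "\<dots> \<le> kact (P s) (\<lambda>y. lam powr (t - s) * u y) x"
      by (intro kact_mono P_kernel s r kact_bpos u bpos_cmult) auto
    also have "\<dots> = lam powr (t - s) * kact (P s) u x" by (simp add: kact_cmult)
    finally have "U t x \<le> lam powr (-t) * (lam powr (t - s) * kact (P s) u x)"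
      unfolding U_def by (intro mult_left_mono) auto
    also have "\<dots> = U s x"
      using lam_pos by (simp add: U_def mult.assoc[symmetric] powr_add[symmetric])
    finally show ?thesis .
  qed
  \<comment> \<open>Integer times suffice: \<open>U\<close> decreases in time, so the sequence
    shifted by a real \<open>s\<close> is squeezed between \<open>U n\<close> and
    \<open>U (n + k)\<close> for an integer \<open>k \<ge> s\<close>.\<close>
  define h where "h x = lim (\<lambda>n. U (real n) x)" for x
  have lim: "(\<lambda>n. U (real n) x) \<longlonglongrightarrow> h x" for x
  proof -
    have "decseq (\<lambda>n. U (real n) x)"
      by (auto simp: decseq_def intro: U_anti)
    moreover have "0 \<le> U (real n) x" for n by (rule bposD(2)[OF bU]) simp
    ultimately have "convergent (\<lambda>n. U (real n) x)"
      by (metis decseq_convergent convergentI)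
    then show ?thesis by (simp add: h_def convergent_LIMSEQ_iff)
  qed
  obtain B where B: "\<And>x. U 0 x \<le> B" using bpos_bound[OF bU[of 0]] by auto
  have U_B: "U (real n) x \<le> B" for n x
    using U_anti[of 0 "real n" x] B[of x] by linarith
  have h: "bpos h"
  proof (rule bposI)
    show "h \<in> borel_measurable borel"
      by (rule borel_measurable_LIMSEQ_real[OF lim bposD(1)[OF bU]]) simp
    show "0 \<le> h x" for x
      by (rule LIMSEQ_le_const[OF lim]) (use bposD(2)[OF bU] in auto)
    show "h x \<le> B" for x
      by (rule LIMSEQ_le_const2[OF lim]) (use U_B in auto)
  qed
  have "0 < h x" for x
  proof -
    \<comment> \<open>A bound depending on \<open>x\<close> but not on time. One factor
      \<open>c0\<close> comes from the minorisation over the last \<open>t0\<close> units of time,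
      which replaces \<open>u\<close> by its integral; the other from the first \<open>t0\<close>
      units, which reduce survival from \<open>x\<close> to survival from \<open>\<nu>\<close>,
      bounded below through \<open>\<kappa>\<close>.\<close>
    define \<delta> where "\<delta> = lam powr (-t0) * (c0 * (\<integral>x. u x \<partial>\<nu>) * (c0 * \<kappa> * kact (P t0) (\<lambda>_. 1) x))"
    have "0 < \<delta>" unfolding \<delta>_def using lam_pos c0_pos u(3) \<kappa>(1) survival_pos by simp
    note T0 = less_imp_le[OF t0_pos]
    have "\<delta> \<le> U (t + t0) x" if t: "0 \<le> t" for t
    proof -
      have bK: "bpos (kact (P s) (\<lambda>_. 1))" if "0 \<le> s" for s
        by (intro kact_bpos P_kernel that bpos_const) simp
      have "c0 * \<kappa> * kact (P t0) (\<lambda>_. 1) x * lam powr t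
          = c0 * (\<kappa> * lam powr t) * kact (P t0) (\<lambda>_. 1) x" by simp
      also have "\<dots> \<le> c0 * (\<integral>y. kact (P t) (\<lambda>_. 1) y \<partial>\<nu>) * kact (P t0) (\<lambda>_. 1) x"
        using \<kappa>(2)[OF t] c0_pos less_imp_le[OF survival_pos[of x]]
        by (intro mult_right_mono mult_left_mono) auto
      also have "\<dots> \<le> kact (P t0) (kact (P t) (\<lambda>_. 1)) x"
        by (intro doeblin_kact bK t)
      \<comment> \<open>The two orders of the semigroup law turn the bound with \<open>P t0\<close>
        applied first in time into one with \<open>P t0\<close> applied last, where the minorisation
        of \<open>u\<close> can be inserted.\<close>
      also have "\<dots> = kact (P t) (kact (P t0) (\<lambda>_. 1)) x"
        using P_semigroup[OF T0 t, of "\<lambda>_. 1" x] P_semigroup[OF t T0, of "\<lambda>_. 1" x]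
        by (simp add: bpos_const add.commute)
      finally have surv: "c0 * \<kappa> * kact (P t0) (\<lambda>_. 1) x * lam powr t
          \<le> kact (P t) (kact (P t0) (\<lambda>_. 1)) x" .
      let ?m = "c0 * (\<integral>x. u x \<partial>\<nu>)"
      have m: "0 \<le> ?m" using c0_pos u(3) by simp
      have "?m * (c0 * \<kappa> * kact (P t0) (\<lambda>_. 1) x * lam powr t)
          \<le> ?m * kact (P t) (kact (P t0) (\<lambda>_. 1)) x"
        using surv m by (rule mult_left_mono)
      also have "\<dots> = kact (P t) (\<lambda>y. ?m * kact (P t0) (\<lambda>_. 1) y) x" by (simp add: kact_cmult)
      also have "\<dots> \<le> kact (P t) (kact (P t0) u) x"
        by (intro kact_mono P_kernel t bpos_cmult bK T0 m kact_bpos u doeblin_kact)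
      also have "\<dots> = kact (P (t + t0)) u x" by (rule P_semigroup[OF t T0 u(1), symmetric])
      finally have "lam powr (-(t + t0)) * (?m * (c0 * \<kappa> * kact (P t0) (\<lambda>_. 1) x * lam powr t)) \<le> U (t + t0) x"
        unfolding U_def by (intro mult_left_mono) auto
      moreover have "lam powr (-(t + t0)) * (?m * (c0 * \<kappa> * kact (P t0) (\<lambda>_. 1) x * lam powr t)) = \<delta>"
        using lam_pos by (simp add: \<delta>_def powr_diff powr_minus field_simps)
      ultimately show ?thesis by simp
    qed
    then have "\<delta> \<le> U (real n) x" if "t0 \<le> real n" for n
      using that by (metis diff_add_cancel diff_ge_0_iff_ge)
    moreover obtain N where "t0 \<le> real N" using real_arch_simple by blast
    ultimately have "\<forall>n\<ge>N. \<delta> \<le> U (real n) x" by (meson of_nat_mono order_trans)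
    then have "\<delta> \<le> h x" by (intro LIMSEQ_le_const[OF lim]) blast
    with \<open>0 < \<delta>\<close> show ?thesis by simp
  qed
  moreover have "kact (P s) h x = lam powr s * h x" if s: "0 \<le> s" for s x
  proof (rule LIMSEQ_unique)
    show "(\<lambda>n. kact (P s) (U (real n)) x) \<longlonglongrightarrow> kact (P s) h x"
      by (rule kact_tendsto[OF P_kernel[OF s] _ h lim U_B]) (simp add: bU)
    have eq: "kact (P s) (U (real n)) x = lam powr s * U (s + real n) x" for n
    proof -
      have "kact (P s) (U (real n)) x = lam powr (- real n) * kact (P (s + real n)) u x"
        by (simp only: U_def[abs_def] kact_cmult P_semigroup[OF s of_nat_0_le_iff u(1)])
      also have "lam powr (- real n) = lam powr s * lam powr (- (s + real n))"
        using lam_pos by (simp add: powr_add[symmetric])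
      finally show ?thesis by (simp only: U_def[abs_def] mult.assoc)
    qed
    obtain k where k: "s \<le> real k" using real_arch_simple by blast
    have "(\<lambda>n. U (s + real n) x) \<longlonglongrightarrow> h x"
    proof (rule tendsto_sandwich[where h="\<lambda>n. U (real n) x"])
      show "(\<lambda>n. U (real (n + k)) x) \<longlonglongrightarrow> h x" using lim by (rule LIMSEQ_ignore_initial_segment)
    qed (use k s in \<open>auto intro!: U_anti always_eventually lim\<close>)
    then show "(\<lambda>n. kact (P s) (U (real n)) x) \<longlonglongrightarrow> lam powr s * h x"
      unfolding eq by (intro tendsto_mult tendsto_const)
  qed
  ultimately show ?thesis using that[OF h] by blast
qed

section \<open>Contraction towards the eigenfunction, and continuity\<close>

text \<open>Doeblin's argument for the \<open>h\<close>-transform: applying \<open>lam powr (-t0) * P\<^sub>t\<^sub>0\<close> to a function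
  between \<open>m h\<close> and \<open>M h\<close> shrinks \<open>M - m\<close> by a fixed factor.\<close>

lemma doeblin_contraction:
  assumes h: "bpos h" "\<And>x. 0 < h x" "\<And>t x. 0 \<le> t \<Longrightarrow> kact (P t) h x = lam powr t * h x"
  obtains \<rho> D m0 where "0 \<le> \<rho>" "\<rho> < 1" "0 < m0"
    "\<And>n. \<exists>m M. m0 \<le> m \<and> M - m \<le> \<rho> ^ n * D \<and>
       (\<forall>x. m * h x \<le> lam powr (- (real (Suc n) * t0)) * kact (P (real (Suc n) * t0)) (\<lambda>_. 1) x \<and>
            lam powr (- (real (Suc n) * t0)) * kact (P (real (Suc n) * t0)) (\<lambda>_. 1) x \<le> M * h x)"
proof -
  note T0 = less_imp_le[OF t0_pos]
  note K0 = P_kernel[OF T0]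
  obtain H where H: "\<And>x. h x \<le> H" "0 < H" using bpos_bound[OF h(1)] by metis
  define N where "N f = (\<integral>x. f x \<partial>\<nu>)" for f :: "'a \<Rightarrow> real"
  define T where "T f x = lam powr (-t0) * kact (P t0) f x" for f x
  \<comment> \<open>Indexing starts at time \<open>t0\<close>: the constant 1 need not be bounded by
    a multiple of \<open>h\<close>, whose infimum may be 0, whereas after one step it is comparable
    with \<open>h\<close> in both directions.\<close>
  define g where "g n x = lam powr (- (real (Suc n) * t0)) * kact (P (real (Suc n) * t0)) (\<lambda>_. 1) x" for n x
  have Th: "T h x = h x" for x
    using lam_pos by (simp add: T_def h(3) T0 powr_minus)
  have T_diff: "T (\<lambda>y. f y - f' y) x = T f x - T f' x" if "bpos f" "bpos f'" for f f' x
    using that by (simp add: T_def kact_diff[OF K0] algebra_simps)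
  have T_cmult: "T (\<lambda>y. c * f y) x = c * T f x" for c f x
    by (simp add: T_def kact_cmult)
  have g0: "g 0 x = T (\<lambda>_. 1) x" for x by (simp add: g_def T_def)
  have bg: "bpos (g n)" for n
    unfolding g_def using T0 by (intro bpos_cmult kact_bpos P_kernel bpos_const) auto
  have g_Suc: "g (Suc n) x = T (g n) x" for n x
  proof -
    have "real (Suc (Suc n)) * t0 = t0 + real (Suc n) * t0" by (simp add: algebra_simps)
    then show ?thesis
      using P_semigroup[OF T0, of "real (Suc n) * t0" "\<lambda>_. 1" x] T0
      by (simp add: g_def[abs_def] T_def kact_cmult bpos_const powr_add[symmetric] mult.assoc[symmetric]
          del: of_nat_Suc)
  qed
  have hT1: "h x \<le> H * T (\<lambda>_. 1) x" for x
  proof -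
    have "kact (P t0) h x \<le> H * kact (P t0) (\<lambda>_. 1) x"
      using kact_mono[OF K0 h(1) bpos_const[of H], of x] H by (simp add: kact_const[OF K0])
    then have "lam powr (-t0) * kact (P t0) h x \<le> lam powr (-t0) * (H * kact (P t0) (\<lambda>_. 1) x)"
      by (intro mult_left_mono) auto
    then show ?thesis using Th[of x] by (simp add: T_def ac_simps)
  qed
  have N_nonneg: "0 \<le> N f" if "bpos f" for f
    unfolding N_def using bposD(2)[OF that] by (intro integral_nonneg_AE) simp
  have T_doeblin: "c0 * N f * T (\<lambda>_. 1) x \<le> T f x" if "bpos f" for f x
    using mult_left_mono[OF doeblin_kact[OF that, of x], of "lam powr (-t0)"]
    by (simp add: T_def N_def ac_simps)
  \<comment> \<open>Since \<open>h = T h \<le> H * T 1\<close>, the minorisation can be expressed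
    with \<open>h\<close> in place of the survival probability.\<close>
  have T_low: "c0 / H * N f * h x \<le> T f x" if "bpos f" for f x
  proof -
    have "c0 / H * N f * h x \<le> c0 / H * N f * (H * T (\<lambda>_. 1) x)"
      using hT1 N_nonneg[OF that] c0_pos H(2) by (intro mult_left_mono) auto
    also have "\<dots> = c0 * N f * T (\<lambda>_. 1) x" using H(2) by simp
    finally show ?thesis using T_doeblin[OF that, of x] by linarith
  qed
  have Nh: "0 < N h"
  proof -
    have "N h \<noteq> 0"
    proof
      assume "N h = 0"
      then have "AE x in \<nu>. h x = 0"
        unfolding N_def using h(1,2) nu_integrable[OF h(1)]
        by (subst (asm) integral_nonneg_eq_0_iff_AE) (auto simp: less_imp_le)
      then have "AE x in \<nu>. False"
        by eventually_elim (use h(2) in \<open>metis less_irrefl\<close>)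
      then show False using prob_space.AE_False[OF nu_prob] by simp
    qed
    with N_nonneg[OF h(1)] show ?thesis by simp
  qed
  define \<rho> where "\<rho> = 1 - c0 / H * N h"
  \<comment> \<open>The gap at \<open>n = 0\<close>, between the upper bound from the minorisation
    of \<open>h\<close> and the lower bound from \<open>h \<le> H\<close>.\<close>
  define D where "D = 1 / (c0 * N h) - 1 / H"
  have \<rho>1: "\<rho> < 1" using c0_pos H(2) Nh by (simp add: \<rho>_def)
  have \<rho>0: "0 \<le> \<rho>"
  proof -
    fix x :: 'a
    have "c0 / H * N h * h x \<le> 1 * h x" using T_low[OF h(1), of x] Th by simp
    then show ?thesis using h(2)[of x] by (subst (asm) mult_le_cancel_right) (auto simp: \<rho>_def)
  qed
  have "\<exists>m M. 1 / H \<le> m \<and> M - m \<le> \<rho> ^ n * D \<and> (\<forall>x. m * h x \<le> g n x \<and> g n x \<le> M * h x)" for n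
  proof (induction n)
    case 0
    have "1 / H * h x \<le> g 0 x" for x
      using hT1[of x] H(2) by (simp add: g0 field_simps)
    moreover have "g 0 x \<le> 1 / (c0 * N h) * h x" for x
      using T_doeblin[OF h(1), of x] c0_pos Nh by (simp add: g0 Th field_simps)
    ultimately show ?case by (intro exI[of _ "1 / H"] exI[of _ "1 / (c0 * N h)"]) (simp add: D_def)
  next
    case (Suc n)
    then obtain m M where mM: "1 / H \<le> m" "M - m \<le> \<rho> ^ n * D"
      "\<And>x. m * h x \<le> g n x" "\<And>x. g n x \<le> M * h x" by blast
    have m0: "0 \<le> m" using mM(1) H(2) by (meson less_imp_le order_trans zero_le_divide_1_iff)
    fix x0 :: 'a
    have "m * h x0 \<le> M * h x0" using mM(3,4) by (rule order_trans)
    then have "m \<le> M" using h(2)[of x0] by simp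
    then have M0: "0 \<le> M" using m0 by simp
    have bm: "bpos (\<lambda>y. m * h y)" and bM: "bpos (\<lambda>y. M * h y)"
      using m0 M0 h(1) by (auto intro: bpos_cmult)
    have b1: "bpos (\<lambda>y. g n y - m * h y)" and b2: "bpos (\<lambda>y. M * h y - g n y)"
      using mM(3,4) by (auto intro: bpos_diff bg bm bM)
    have N1: "N (\<lambda>y. g n y - m * h y) = N (g n) - m * N h"
      unfolding N_def
      by (subst Bochner_Integration.integral_diff) (simp_all add: nu_integrable bg bm h(1))
    have N2: "N (\<lambda>y. M * h y - g n y) = M * N h - N (g n)"
      unfolding N_def
      by (subst Bochner_Integration.integral_diff) (simp_all add: nu_integrable bg bM h(1))
    \<comment> \<open>\<open>T_low\<close> applied to \<open>g n - m * h\<close> raises the lower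
      bound, and applied to \<open>M * h - g n\<close> lowers the upper one. The unknown integral of
      \<open>g n\<close> cancels in the difference, leaving exactly the factor
      \<open>\<rho>\<close>.\<close>
    define m' where "m' = m + c0 / H * (N (g n) - m * N h)"
    define M' where "M' = M - c0 / H * (M * N h - N (g n))"
    have "m' * h x \<le> g (Suc n) x" for x
      using T_low[OF b1, of x] by (simp add: T_diff[OF bg bm] T_cmult Th N1 g_Suc m'_def distrib_right)
    moreover have "g (Suc n) x \<le> M' * h x" for x
      using T_low[OF b2, of x] by (simp add: T_diff[OF bM bg] T_cmult Th N2 g_Suc M'_def left_diff_distrib)
    moreover have "m \<le> m'"
      using N_nonneg[OF b1] c0_pos H(2) by (simp add: m'_def N1)
    moreover have "M' - m' \<le> \<rho> ^ Suc n * D"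
    proof -
      have "(M - e * (M * q - r)) - (m + e * (r - m * q)) = (1 - e * q) * (M - m)" for e q r
        by (simp add: algebra_simps)
      then have "M' - m' = \<rho> * (M - m)" unfolding M'_def m'_def \<rho>_def .
      also have "\<dots> \<le> \<rho> * (\<rho> ^ n * D)" using mM(2) \<rho>0 by (rule mult_left_mono)
      finally show ?thesis by simp
    qed
    ultimately show ?case using mM(1) by (intro exI[of _ m'] exI[of _ M']) auto
  qed
  then show ?thesis
    using that[of \<rho> "1 / H" D] \<rho>0 \<rho>1 H(2) unfolding g_def by auto
qed

text \<open>Dividing by the lower constants \<open>m n\<close> normalises the approximants, so their
  convergence need not be discussed. These constants stay above \<open>m0\<close>, so the error is
  at most the gap times \<open>H / m0\<close>, uniformly in \<open>x\<close>.\<close>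

lemma eigenfunction_continuous_on:
  assumes h: "bpos h" "\<And>x. 0 < h x" "\<And>t x. 0 \<le> t \<Longrightarrow> kact (P t) h x = lam powr t * h x"
    and cont: "\<And>t. 0 \<le> t \<Longrightarrow> continuous_on V (kact (P t) (\<lambda>_. 1))"
  shows "continuous_on V h"
proof -
  obtain \<rho> D m0 where \<rho>: "0 \<le> \<rho>" "\<rho> < 1" "0 < m0" and *:
    "\<And>n. \<exists>m M. m0 \<le> m \<and> M - m \<le> \<rho> ^ n * D \<and>
       (\<forall>x. m * h x \<le> lam powr (- (real (Suc n) * t0)) * kact (P (real (Suc n) * t0)) (\<lambda>_. 1) x \<and>
            lam powr (- (real (Suc n) * t0)) * kact (P (real (Suc n) * t0)) (\<lambda>_. 1) x \<le> M * h x)"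
    using doeblin_contraction[OF h] by metis
  define g where "g n x = lam powr (- (real (Suc n) * t0)) * kact (P (real (Suc n) * t0)) (\<lambda>_. 1) x" for n x
  obtain m M where mM: "\<And>n. m0 \<le> m n" "\<And>n. M n - m n \<le> \<rho> ^ n * D"
    "\<And>n x. m n * h x \<le> g n x" "\<And>n x. g n x \<le> M n * h x"
    using *[folded g_def] by metis
  obtain H where H: "\<And>x. h x \<le> H" "0 < H" using bpos_bound[OF h(1)] by metis
  have m_pos: "0 < m n" for n using mM(1)[of n] \<rho>(3) by linarith
  have bound: "norm (g n x / m n - h x) \<le> \<rho> ^ n * (D * H / m0)" for n x
  proof -
    have "0 \<le> g n x - m n * h x" using mM(3)[of n x] by simp
    have "m n * h x \<le> M n * h x" using mM(3,4) by (rule order_trans)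
    then have D0: "0 \<le> M n - m n" using h(2)[of x] by simp
    have "norm (g n x / m n - h x) = (g n x - m n * h x) / m n"
      using m_pos[of n] mM(3)[of n x] by (simp add: field_simps)
    also have "\<dots> \<le> ((M n - m n) * h x) / m0"
      using mM(1,3,4)[of n] D0 \<rho>(3) h(2)[of x] by (intro frac_le) (auto simp: left_diff_distrib)
    also have "\<dots> \<le> ((\<rho> ^ n * D) * H) / m0"
      using mM(2)[of n] D0 H h(2)[of x] \<rho>(3) by (intro divide_right_mono mult_mono) auto
    finally show ?thesis by simp
  qed
  have "(\<lambda>n. \<rho> ^ n * (D * H / m0)) \<longlonglongrightarrow> 0 * (D * H / m0)"
    using \<rho> by (intro tendsto_mult tendsto_const LIMSEQ_power_zero) auto
  then have lim: "(\<lambda>n. \<rho> ^ n * (D * H / m0)) \<longlonglongrightarrow> 0" by simp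
  have "uniform_limit V (\<lambda>n x. g n x / m n) h sequentially"
  proof (rule uniform_limitI)
    fix e :: real assume "0 < e"
    then have "\<forall>\<^sub>F n in sequentially. \<rho> ^ n * (D * H / m0) < e"
      by (rule order_tendstoD(2)[OF lim])
    then show "\<forall>\<^sub>F n in sequentially. \<forall>x\<in>V. dist (g n x / m n) (h x) < e"
      by eventually_elim (metis bound dist_norm le_less_trans)
  qed
  moreover have "continuous_on V (\<lambda>x. g n x / m n)" for n
    unfolding g_def using t0_pos m_pos[of n] by (intro continuous_intros cont) auto
  ultimately show ?thesis
    by (intro uniform_limit_theorem[where F=sequentially and l=h] always_eventually) auto
qed

end

theorem mainTheorem13:
  fixes \<Lambda> :: "'a::metric_space measure"
    and P Q :: "real \<Rightarrow> 'a \<Rightarrow> 'a measure"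
    and \<psi> :: "'a \<Rightarrow> real"
    and a c0 t0 c1 t1 :: real
    and \<nu> \<pi> :: "'a measure"
    and \<O> :: "'a set"
  assumes Lambda_sets: "sets \<Lambda> = sets borel"
    and Lambda_sigma: "sigma_finite_measure \<Lambda>"
    and Lambda_support: "\<And>U. open U \<Longrightarrow> U \<noteq> {} \<Longrightarrow> emeasure \<Lambda> U > 0"
    and P_sg: "submarkov_semigroup P"
    and separable: "separable_space (euclidean :: 'a topology)"
    and survive: "\<And>x t. 0 \<le> t \<Longrightarrow> measure (P t x) UNIV > 0"
    and c0_pos: "c0 > 0" and t0_pos: "t0 > 0"
    and nu_prob: "prob_space \<nu>" and nu_sets: "sets \<nu> = sets borel"
    and doeblin: "\<And>x A. A \<in> sets borel \<Longrightarrow>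
                    measure (P t0 x) A / measure (P t0 x) UNIV \<ge> c0 * measure \<nu> A"
    and P_lsc: "\<And>t. 0 \<le> t \<Longrightarrow> lsc_kernel (P t)"
    and psi: "Cb_pos \<psi>"
    and a_pos: "a > 0"
    and Q_sg: "submarkov_semigroup Q"
    and duality: "\<And>t A B. 0 \<le> t \<Longrightarrow> A \<in> sets borel \<Longrightarrow> B \<in> sets borel \<Longrightarrow>
        (\<integral>\<^sup>+ x\<in>A. ennreal (\<psi> x) * emeasure (P t x) B \<partial>\<Lambda>)
        = ennreal (a powr t) * (\<integral>\<^sup>+ y\<in>B. ennreal (\<psi> y) * emeasure (Q t y) A \<partial>\<Lambda>)"
    and pi_QSD: "is_QSD Q \<pi>"
    and pi_Pinf: "P_infty \<Lambda> \<pi>"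
    and O_open: "open \<O>"
    and c1_pos: "c1 > 0" and t1_pos: "t1 > 0"
    and pi_lower: "\<And>A. A \<in> sets borel \<Longrightarrow> emeasure \<pi> A \<ge> ennreal c1 * emeasure \<Lambda> (A \<inter> \<O>)"
    and nu_reach: "(\<integral>\<^sup>+ x. emeasure (P t1 x) \<O> \<partial>\<nu>) > 0"
  shows "let lam = a * (\<integral> y. measure (Q 1 y) UNIV \<partial>\<pi>) in
     lam > 0 \<and>
     (\<exists>h. h \<in> borel_measurable borel \<and> bounded (range h) \<and> (\<forall>x. h x > 0) \<and>
          (\<forall>t\<ge>0. \<forall>x. kact (P t) h x = lam powr t * h x)) \<and>
     (\<forall>V. open V \<and>
          (\<forall>t\<ge>0. \<forall>f. bounded (range f) \<and> (\<forall>x. 0 \<le> f x) \<and> lsc f \<and> continuous_on V f \<longrightarrow>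
              bounded (range (kact (P t) f)) \<and> (\<forall>x. 0 \<le> kact (P t) f x) \<and>
              lsc (kact (P t) f) \<and> continuous_on V (kact (P t) f))
        \<longrightarrow> (\<exists>h. h \<in> borel_measurable borel \<and> bounded (range h) \<and> (\<forall>x. h x > 0) \<and>
              (\<forall>t\<ge>0. \<forall>x. kact (P t) h x = lam powr t * h x) \<and> continuous_on V h))"
proof -
  interpret assumption_E \<Lambda> P Q \<psi> a c0 t0 c1 t1 \<nu> \<pi> \<O>
    by (rule assumption_E.intro) (fact assms)+
  obtain h where h: "bpos h" "\<And>x. 0 < h x" "\<And>t x. 0 \<le> t \<Longrightarrow> kact (P t) h x = lam powr t * h x"
    using positive_eigenfunction by metis
  have lam: "a * (\<integral> y. measure (Q 1 y) UNIV \<partial>\<pi>) = lam"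
    using a_pos by (simp add: eigenvalue_def)
  \<comment> \<open>The constant 1 is the test function: it is lower semicontinuous and continuous
    on every \<open>V\<close>, so the same \<open>h\<close> serves for all \<open>V\<close>.\<close>
  have cont: "continuous_on V h"
    if V: "\<forall>t\<ge>0. \<forall>f. bounded (range f) \<and> (\<forall>x. 0 \<le> f x) \<and> lsc f \<and> continuous_on V f \<longrightarrow>
              bounded (range (kact (P t) f)) \<and> (\<forall>x. 0 \<le> kact (P t) f x) \<and>
              lsc (kact (P t) f) \<and> continuous_on V (kact (P t) f)" for V
  proof (rule eigenfunction_continuous_on[OF h])
    have "bounded (range (\<lambda>_::'a. 1::real)) \<and> (\<forall>x::'a. 0 \<le> (1::real)) \<and> lsc (\<lambda>_::'a. 1::real)
        \<and> continuous_on V (\<lambda>_::'a. 1::real)"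
      by (simp add: lsc_def)
    then show "continuous_on V (kact (P t) (\<lambda>_. 1))" if "0 \<le> t" for t
      using V that by blast
  qed
  have "h \<in> borel_measurable borel" "bounded (range h)"
    using h(1) by (auto simp: bpos_def)
  with h cont lam_pos show ?thesis
    unfolding Let_def lam by blast
qed

end
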